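(* Let $G_+\subset\mathbb{C}$ be a bounded finitely connected domain whose boundary $C=\partial G_+$ is a rectifiable Carleson curve, consisting of finitely many pairwise disjoint simple closed curves, and let $G_-=\widehat{\mathbb{C}}\setminus \overline{G_+}$ (so $\infty\in G_-$). Let $w\colon C\to[0,\infty)$ be a measurable weight such that $w\not\equiv 0$ on each connected component of $C$, and suppose $w\in L^1(C,|dz|)$. Then the following conditions are equivalent: 1) for all $\lambda\in G_+$ and all (finite) $\mu\in G_-$, $$\left(\frac{1}{z-\lambda},\frac{1}{z-\mu}\right)_{L^2(C,w)}=\frac{1}{2\pi}\int_C \frac{1}{z-\lambda}\,\overline{\left(\frac{1}{z-\mu}\right)}\,w(z)\,|dz|=0;$$ 2) the curve $C$ is a circle and $w$ is constant on $C$.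
   Context: $|dz|$ denotes arc-length measure on $C$. The inner product on $L^2(C,w(z)|dz|)$ is $(f,g)_{L^2(C,w)}=\frac{1}{2\pi}\int_C f(z)\overline{g(z)}\,w(z)\,|dz|$. $\widehat{\mathbb{C}}=\mathbb{C}\cup\{\infty\}$ is the Riemann sphere. A rectifiable curve $C$ is a Carleson curve if $\sup_{z\in C,\,\varepsilon>0}\varepsilon^{-1}\,|C\cap\{\zeta:|\zeta-z|<\varepsilon\}|<\infty$, where $|\cdot|$ is arc length. Statements about $w$ (such as $w\not\equiv0$ or $w$ constant) are understood up to sets of arc-length measure zero. *)

theory Defs
  imports "HOL-Analysis.Analysis"
begin

text \<open>The complement is taken in the plane rather than on the Riemann sphere. For bounded \<open>G\<close> this
  does not change the number of components: exactly one component of \<open>- G\<close> is unbounded, and on the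
  sphere it only gains the point at infinity.\<close>

definition bounded_finitely_connected_domain :: "complex set \<Rightarrow> bool" where
  "bounded_finitely_connected_domain G \<longleftrightarrow>
     G \<noteq> {} \<and> open G \<and> connected G \<and> bounded G \<and> finite (components (- G))"

definition length_between :: "(real \<Rightarrow> complex) \<Rightarrow> real \<Rightarrow> real \<Rightarrow> ennreal" where
  "length_between \<gamma> a b =
     (SUP ts \<in> {ts. sorted ts \<and> set ts \<subseteq> {a..b}}.
        \<Sum>i<length ts - 1. ennreal (dist (\<gamma> (ts ! i)) (\<gamma> (ts ! Suc i))))"

definition rectifiable_path :: "(real \<Rightarrow> complex) \<Rightarrow> bool" where
  "rectifiable_path \<gamma> \<longleftrightarrow> path \<gamma> \<and> length_between \<gamma> 0 1 < \<infinity>"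

definition rectifiable_jordan_path :: "(real \<Rightarrow> complex) \<Rightarrow> bool" where
  "rectifiable_jordan_path \<gamma> \<longleftrightarrow>
     simple_path \<gamma> \<and> pathfinish \<gamma> = pathstart \<gamma> \<and> rectifiable_path \<gamma>"

text \<open>The function \<open>t \<mapsto> length of \<gamma> on [0,t]\<close>, continued by \<open>0\<close> to the left of \<open>0\<close>
  (where the interval, hence every admissible partition, is empty) and by the total length to the
  right of \<open>1\<close>. For a rectifiable path it is continuous and nondecreasing, so that
  \<open>interval_measure\<close> yields its Stieltjes measure.\<close>

definition length_fun :: "(real \<Rightarrow> complex) \<Rightarrow> real \<Rightarrow> real" where
  "length_fun \<gamma> t = enn2real (length_between \<gamma> 0 (min t 1))"

text \<open>A curve consisting of several simple closed curves is given by the set \<open>\<Gamma>\<close> of their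
  parametrizations (one for each of them).\<close>

definition curve_image :: "(real \<Rightarrow> complex) set \<Rightarrow> complex set" where
  "curve_image \<Gamma> = (\<Union>\<gamma>\<in>\<Gamma>. path_image \<gamma>)"

text \<open>The completion makes measurability of a weight mean measurability with respect to arc length,
  and not only Borel measurability. The underlying space is the curve, so values of functions
  outside the curve are irrelevant.\<close>

definition arc_length_measure :: "(real \<Rightarrow> complex) set \<Rightarrow> complex measure" where
  "arc_length_measure \<Gamma> =
     completion (measure_of (curve_image \<Gamma>) (sets (restrict_space borel (curve_image \<Gamma>)))
       (\<lambda>A. \<Sum>\<gamma>\<in>\<Gamma>. emeasure (interval_measure (length_fun \<gamma>)) {t\<in>{0..1}. \<gamma> t \<in> A}))"

definition carleson_curve :: "(real \<Rightarrow> complex) set \<Rightarrow> bool" where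
  "carleson_curve \<Gamma> \<longleftrightarrow>
     (SUP z\<in>curve_image \<Gamma>. SUP \<epsilon>\<in>{0<..}.
        emeasure (arc_length_measure \<Gamma>) (curve_image \<Gamma> \<inter> {\<zeta>. dist \<zeta> z < \<epsilon>}) / ennreal \<epsilon>) < \<infinity>"

definition weighted_inner ::
  "(real \<Rightarrow> complex) set \<Rightarrow> (complex \<Rightarrow> real) \<Rightarrow> (complex \<Rightarrow> complex) \<Rightarrow> (complex \<Rightarrow> complex) \<Rightarrow> complex" where
  "weighted_inner \<Gamma> w f g =
     1 / (2 * of_real pi) *
       (\<integral>z. f z * cnj (g z) * of_real (w z) \<partial>arc_length_measure \<Gamma>)"

end

theory Submission
  imports Defs "HOL-Computational_Algebra.Polynomial" "HOL-Real_Asymp.Real_Asymp"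
begin

text \<open>Let \<open>\<nu>\<close> be the measure \<open>w |dz|\<close>. Letting \<open>\<mu> \<rightarrow> \<infinity>\<close> in the orthogonality relation gives
  \<open>\<integral> cnj (z - c)^n / (z - l) d\<nu>(z) = 0\<close> for all \<open>n\<close> and all \<open>l\<close> in \<open>G\<close>. Hence, for \<open>m \<ge> 1\<close>, the function
  \<open>z \<mapsto> \<integral> (cnj z - cnj u) (cnj (z - c)^m - cnj (u - c)^m) / (u - z) d\<nu>(u)\<close> vanishes on \<open>G\<close>, and since its
  integrand is continuous also at \<open>u = z\<close>, it vanishes on the boundary as well. Integrating it against
  \<open>(z - c)^k d\<nu>(z)\<close> and symmetrising in \<open>z\<close> and \<open>u\<close> gives identities between the moments
  \<open>M i j = \<integral> (z - c)^i cnj (z - c)^j d\<nu>\<close>. If \<open>c\<close> is the centre of mass of \<open>\<nu>\<close>, then \<open>k = 1\<close> yields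
  \<open>M 0 m = 0\<close> for all \<open>m \<ge> 1\<close>, and \<open>m = 1\<close>, \<open>k = 3\<close> yields \<open>M 2 2 M 0 0 = (M 1 1)^2\<close>. By the latter
  \<open>|z - c|^2\<close> has variance zero, so \<open>\<nu>\<close> lives on a circle, and by the former it is rotation invariant.
  Consequently the circle is contained in \<open>C\<close> and, as \<open>w\<close> does not vanish on any component, every
  component of \<open>C\<close> contains it; so \<open>C\<close> is a single Jordan curve containing a circle, that is, the
  circle. Arc length on the circle is rotation invariant too, which makes \<open>w\<close> constant.\<close>

section \<open>Orthogonality to polynomials\<close>

lemma measurable_cnj [measurable]: "cnj \<in> borel_measurable borel"
  by (intro borel_measurable_continuous_onI continuous_intros)

text \<open>Continuity is asked on \<open>C\<close> only and measurability everywhere, so that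
  Cauchy kernels with poles off \<open>C\<close> are covered. A bound on \<open>C\<close> suffices
  because \<open>M\<close> is finite and lives there.\<close>

lemma integrable_on_compact_support:
  fixes f :: "'a::topological_space \<Rightarrow> 'b::{banach, second_countable_topology}"
  assumes "finite_measure M" "sets M = sets borel" "AE z in M. z \<in> C" "compact C"
    and f: "f \<in> borel_measurable borel" "continuous_on C f"
  shows "integrable M f"
proof -
  interpret finite_measure M by fact
  have "bounded (f ` C)"
    by (intro compact_imp_bounded compact_continuous_image f assms)
  then obtain B where B: "\<And>z. z \<in> C \<Longrightarrow> norm (f z) \<le> B"
    unfolding bounded_iff by blast
  show ?thesis
  proof (rule integrable_const_bound)
    show "AE x in M. norm (f x) \<le> B" using assms(3) by eventually_elim (rule B)
    show "f \<in> borel_measurable M"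
      using f(1) assms(2) by (simp cong: measurable_cong_sets)
  qed
qed

text \<open>Letting \<open>\<mu> \<rightarrow> \<infinity>\<close> turns orthogonality to the kernels \<open>1 / (z - \<mu>)\<close> into orthogonality to the
  polynomials.\<close>

lemma orthogonal_to_polynomials:
  fixes M :: "complex measure" and c l :: complex
  assumes M: "finite_measure M" "sets M = sets borel" "AE z in M. z \<in> C" "compact C"
    and l: "l \<notin> C"
    and orth: "\<And>\<mu>. R < norm \<mu> \<Longrightarrow> (\<integral>z. 1 / (z - l) * cnj (1 / (z - \<mu>)) \<partial>M) = 0"
  shows "(\<integral>z. cnj (z - c) ^ n / (z - l) \<partial>M) = 0"
proof -
  interpret finite_measure M by fact
  have [measurable_cong]: "sets M = sets borel" by fact
  obtain B where B: "\<And>z. z \<in> C \<Longrightarrow> norm z \<le> B" "0 < B"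
    using compact_imp_bounded[OF \<open>compact C\<close>] by (auto simp: bounded_pos)
  \<comment> \<open>For \<open>norm \<mu> > 2 * B\<close> and \<open>z\<close> in \<open>C\<close>
    one has \<open>norm (\<mu> - z) \<ge> norm \<mu> / 2\<close>. This keeps the kernel finite on
    \<open>C\<close> and yields the dominating factor 2 below.\<close>
  define Q where "Q = max R (2 * B)"
  have nz: "z - l \<noteq> 0" "z - \<mu> \<noteq> 0" if "Q < norm \<mu>" "z \<in> C" for \<mu> z
    using that B l by (force simp: Q_def)+
  have int1: "integrable M (\<lambda>z. cnj (z - c) ^ n / (z - l))" for n
    by (rule integrable_on_compact_support[OF M]) (auto intro!: continuous_on_divide continuous_on_power continuous_on_cnj continuous_on_diff simp: l) 
  have int2: "integrable M (\<lambda>z. cnj (z - c) ^ n / (z - l) * cnj (1 / (z - \<mu>)))"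
    if "Q < norm \<mu>" for n \<mu>
    by (rule integrable_on_compact_support[OF M])
      (use nz[OF that] in \<open>auto intro!: continuous_on_mult continuous_on_divide continuous_on_power continuous_on_cnj continuous_on_diff simp: l\<close>)
  \<comment> \<open>Multiplied by \<open>- \<mu>\<close>, the kernel tends to 1 as
    \<open>\<mu>\<close> tends to infinity. The sequence chosen is real, so that
    \<open>cnj (\<mu> k) = \<mu> k\<close>.\<close>
  have step: "(\<integral>z. cnj (z - c) ^ n / (z - l) \<partial>M) = 0"
    if H: "\<And>\<mu>. Q < norm \<mu> \<Longrightarrow> (\<integral>z. cnj (z - c) ^ n / (z - l) * cnj (1 / (z - \<mu>)) \<partial>M) = 0" for n
  proof -
    define \<mu> where "\<mu> k = complex_of_real (Q + 1 + real k)" for k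
    have Q0: "0 < Q" using B by (simp add: Q_def)
    have mu: "Q < norm (\<mu> k)" for k unfolding \<mu>_def norm_of_real using Q0 by linarith
    have "(\<lambda>k. \<integral>z. cnj (z - c) ^ n / (z - l) * (\<mu> k / cnj (\<mu> k - z)) \<partial>M)
       \<longlonglongrightarrow> (\<integral>z. cnj (z - c) ^ n / (z - l) * 1 \<partial>M)"
    proof (rule integral_dominated_convergence)
      show "integrable M (\<lambda>z. 2 * norm (cnj (z - c) ^ n / (z - l)))"
        using int1[of n] by (intro integrable_mult_right integrable_norm)
      show "AE z in M. (\<lambda>k. cnj (z - c) ^ n / (z - l) * (\<mu> k / cnj (\<mu> k - z)))
         \<longlonglongrightarrow> cnj (z - c) ^ n / (z - l) * 1"
      proof (intro AE_I2 tendsto_mult tendsto_const)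
        fix z
        have "filterlim (\<lambda>k. Q + 1 + real k) at_top sequentially"
          by (intro filterlim_tendsto_add_at_top[OF tendsto_const] filterlim_real_sequentially)
        hence "filterlim \<mu> at_infinity sequentially"
          unfolding \<mu>_def by (rule filterlim_compose[OF filterlim_of_real_at_infinity])
        hence "(\<lambda>k. cnj z / \<mu> k) \<longlonglongrightarrow> 0"
          by (intro tendsto_divide_0[OF tendsto_const])
        hence "(\<lambda>k. 1 / (1 - cnj z / \<mu> k)) \<longlonglongrightarrow> 1 / (1 - 0)"
          by (intro tendsto_intros) auto
        moreover have "1 / (1 - cnj z / \<mu> k) = \<mu> k / cnj (\<mu> k - z)" for k
        proof -
          have "\<mu> k \<noteq> 0" using mu[of k] Q0 by auto
          moreover have "cnj (\<mu> k) = \<mu> k" by (simp add: \<mu>_def)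
          ultimately show ?thesis by (simp add: field_simps)
        qed
        ultimately show "(\<lambda>k. \<mu> k / cnj (\<mu> k - z)) \<longlonglongrightarrow> 1" by simp
      qed
      show "AE z in M. norm (cnj (z - c) ^ n / (z - l) * (\<mu> k / cnj (\<mu> k - z)))
         \<le> 2 * norm (cnj (z - c) ^ n / (z - l))" for k
        using M(3)
      proof eventually_elim
        fix z assume "z \<in> C"
        hence "2 * norm z \<le> norm (\<mu> k)" using B(1)[of z] mu[of k] by (simp add: Q_def)
        hence "norm (\<mu> k) \<le> 2 * norm (\<mu> k - z)"
          using norm_triangle_ineq2[of "\<mu> k" z] by simp
        moreover from this have "0 < norm (\<mu> k - z)" using mu[of k] Q0 by linarith
        ultimately have "norm (\<mu> k / cnj (\<mu> k - z)) \<le> 2"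
          unfolding norm_divide complex_mod_cnj by (simp only: pos_divide_le_eq)
        thus "norm (cnj (z - c) ^ n / (z - l) * (\<mu> k / cnj (\<mu> k - z)))
         \<le> 2 * norm (cnj (z - c) ^ n / (z - l))"
          unfolding norm_mult[of "_ / _" "_ / _"]
          by (metis mult.commute mult_right_mono norm_ge_zero)
      qed
    qed measurable
    moreover have "(\<integral>z. cnj (z - c) ^ n / (z - l) * (\<mu> k / cnj (\<mu> k - z)) \<partial>M) = 0" for k
    proof -
      have "(\<lambda>z. cnj (z - c) ^ n / (z - l) * (\<mu> k / cnj (\<mu> k - z)))
        = (\<lambda>z. (- \<mu> k) * (cnj (z - c) ^ n / (z - l) * cnj (1 / (z - \<mu> k))))"
      proof
        fix z
        have "cnj (1 / (z - \<mu> k)) = - (1 / cnj (\<mu> k - z))"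
          by (metis complex_cnj_divide complex_cnj_minus complex_cnj_one divide_minus_right minus_diff_eq)
        thus "cnj (z - c) ^ n / (z - l) * (\<mu> k / cnj (\<mu> k - z))
          = (- \<mu> k) * (cnj (z - c) ^ n / (z - l) * cnj (1 / (z - \<mu> k)))" by simp
      qed
      thus ?thesis by (simp only: integral_mult_right_zero H[OF mu] mult_zero_right)
    qed
    ultimately show ?thesis by (simp add: LIMSEQ_const_iff)
  qed
  \<comment> \<open>Writing \<open>cnj (z - c) = cnj (z - \<mu>) + cnj (\<mu> - c)\<close> cancels
    the kernel in the first summand. Degree \<open>Suc n\<close> thus reduces to degree
    \<open>n\<close> without the kernel, zero by \<open>step\<close>, and with it, zero by
    induction. \<open>\<mu>\<close> is arbitrary because \<open>step\<close> asks for all large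
    \<open>\<mu>\<close>.\<close>
  have "(\<integral>z. cnj (z - c) ^ n / (z - l) * cnj (1 / (z - \<mu>)) \<partial>M) = 0" if "Q < norm \<mu>" for \<mu>
    using that
  proof (induction n arbitrary: \<mu>)
    case 0
    thus ?case using orth[of \<mu>] by (simp add: Q_def)
  next
    case (Suc n)
    have "(\<integral>z. cnj (z - c) ^ Suc n / (z - l) * cnj (1 / (z - \<mu>)) \<partial>M)
      = (\<integral>z. cnj (z - c) ^ n / (z - l) +
           cnj (\<mu> - c) * (cnj (z - c) ^ n / (z - l) * cnj (1 / (z - \<mu>))) \<partial>M)"
    proof (rule integral_cong_AE)
      show "AE z in M. cnj (z - c) ^ Suc n / (z - l) * cnj (1 / (z - \<mu>)) =
        cnj (z - c) ^ n / (z - l) + cnj (\<mu> - c) * (cnj (z - c) ^ n / (z - l) * cnj (1 / (z - \<mu>)))"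
        using M(3)
      proof eventually_elim
        fix z assume "z \<in> C"
        have e: "(y + d) ^ Suc 0 * P / x * (1 / y) = P / x + d * (P / x * (1 / y))"
          if "x \<noteq> 0" "y \<noteq> 0" for x y d P :: complex
          using that by (simp add: field_simps)
        have "cnj (z - c) = cnj (z - \<mu>) + cnj (\<mu> - c)" by simp
        thus "cnj (z - c) ^ Suc n / (z - l) * cnj (1 / (z - \<mu>)) =
          cnj (z - c) ^ n / (z - l) + cnj (\<mu> - c) * (cnj (z - c) ^ n / (z - l) * cnj (1 / (z - \<mu>)))"
          using e[of "z - l" "cnj (z - \<mu>)" "cnj (\<mu> - c)" "cnj (z - c) ^ n"]
            nz[OF Suc.prems \<open>z \<in> C\<close>]
          by (simp del: complex_cnj_diff)
      qed
    qed measurable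
    also have "\<dots> = (\<integral>z. cnj (z - c) ^ n / (z - l) \<partial>M) +
        cnj (\<mu> - c) * (\<integral>z. cnj (z - c) ^ n / (z - l) * cnj (1 / (z - \<mu>)) \<partial>M)"
      by (simp only: Bochner_Integration.integral_add[OF int1 integrable_mult_right[OF int2[OF Suc.prems]]]
          integral_mult_right_zero)
    also have "\<dots> = 0"
      using Suc.IH[OF Suc.prems] step[OF Suc.IH] by simp
    finally show ?case .
  qed
  thus ?thesis by (rule step)
qed


section \<open>Moment identities\<close>

text \<open>Off the diagonal the first factor divided by \<open>u - z\<close> has modulus 1, while
  the second tends to 0 at the diagonal. The quotient by \<open>u - z\<close> is therefore
  continuous across \<open>u = z\<close>, with the value 0 that division by zero assigns.\<close>

definition conj_diffs :: "complex \<Rightarrow> nat \<Rightarrow> complex \<Rightarrow> complex \<Rightarrow> complex" where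
  "conj_diffs c m z u = (cnj z - cnj u) * (cnj (z - c) ^ m - cnj (u - c) ^ m)"

lemma conj_diffs_alt:
  "conj_diffs c m z u = (cnj (z - c) - cnj (u - c)) * (cnj (z - c) ^ m - cnj (u - c) ^ m)"
  by (simp add: conj_diffs_def)

lemma conj_diffs_commute: "conj_diffs c m u z = conj_diffs c m z u"
  by (simp add: conj_diffs_def algebra_simps)

lemma conj_diffs_refl [simp]: "conj_diffs c m z z = 0"
  by (simp add: conj_diffs_def)

lemma norm_conj_diffs_quotient_le:
  "norm (conj_diffs c m z u / (u - z)) \<le> norm (cnj (z - c) ^ m - cnj (u - c) ^ m)"
proof (cases "u = z")
  case False
  have "norm (cnj z - cnj u) = norm (u - z)"
    by (metis complex_cnj_diff complex_mod_cnj norm_minus_commute)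
  with False show ?thesis
    by (simp add: conj_diffs_def norm_mult norm_divide)
qed simp

lemma tendsto_conj_diffs_quotient:
  assumes "1 \<le> m" "(f \<longlongrightarrow> z) F"
  shows "((\<lambda>n. conj_diffs c m (f n) u / (u - f n)) \<longlongrightarrow> conj_diffs c m z u / (u - z)) F"
proof (cases "u = z")
  case False
  thus ?thesis unfolding conj_diffs_def
    by (intro tendsto_intros assms) auto
next
  case True
  have "((\<lambda>n. cnj (f n - c) ^ m - cnj (u - c) ^ m) \<longlongrightarrow> cnj (z - c) ^ m - cnj (u - c) ^ m) F"
    by (intro tendsto_intros assms)
  hence "((\<lambda>n. cnj (f n - c) ^ m - cnj (u - c) ^ m) \<longlongrightarrow> 0) F"
    using True by simp
  hence "((\<lambda>n. norm (cnj (f n - c) ^ m - cnj (u - c) ^ m)) \<longlongrightarrow> 0) F"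
    by (rule tendsto_norm_zero)
  hence "((\<lambda>n. conj_diffs c m (f n) u / (u - f n)) \<longlongrightarrow> 0) F"
    by (rule Lim_null_comparison[rotated]) (intro always_eventually allI norm_conj_diffs_quotient_le)
  thus ?thesis using True by simp
qed

locale planar_compact_measure = finite_measure M for M :: "complex measure" +
  fixes C :: "complex set"
  assumes sets_M [measurable_cong]: "sets M = sets borel"
    and AE_C: "AE z in M. z \<in> C"
    and compact_C: "compact C"
begin

lemma integrable_continuous:
  fixes f :: "complex \<Rightarrow> 'b::{banach, second_countable_topology}"
  assumes "f \<in> borel_measurable borel" "continuous_on C f"
  shows "integrable M f"
  using integrable_on_compact_support[OF finite_measure_axioms sets_M AE_C compact_C assms] .

lemma integrable_moment: "integrable M (\<lambda>u. (u - c) ^ i * cnj (u - c) ^ j)"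
  by (rule integrable_continuous) (auto intro!: continuous_intros)

definition moment :: "complex \<Rightarrow> nat \<Rightarrow> nat \<Rightarrow> complex" where
  "moment c i j = (\<integral>u. (u - c) ^ i * cnj (u - c) ^ j \<partial>M)"

lemma moment_commute: "moment c j i = cnj (moment c i j)"
proof -
  have "cnj (moment c i j) = (\<integral>u. cnj ((u - c) ^ i * cnj (u - c) ^ j) \<partial>M)"
    unfolding moment_def by (rule Bochner_Integration.integral_cnj[symmetric])
  thus ?thesis by (simp add: moment_def mult.commute del: Bochner_Integration.integral_cnj)
qed

lemma bounded_powers: 
  obtains B where "0 \<le> B" "\<And>z u. z \<in> C \<Longrightarrow> u \<in> C \<Longrightarrow> norm (cnj (z - c) ^ m - cnj (u - c) ^ m) \<le> B"
proof -
  have "bounded ((\<lambda>z. cnj (z - c) ^ m) ` C)"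
    by (intro compact_imp_bounded compact_continuous_image continuous_intros compact_C)
  then obtain B where B: "\<And>z. z \<in> C \<Longrightarrow> norm (cnj (z - c) ^ m) \<le> B" "0 < B"
    unfolding bounded_pos by (auto simp del: complex_cnj_diff)
  show ?thesis
  proof (rule that[of "B + B"])
    show "norm (cnj (z - c) ^ m - cnj (u - c) ^ m) \<le> B + B" if "z \<in> C" "u \<in> C" for z u
      using B(1)[OF that(1)] B(1)[OF that(2)] norm_triangle_ineq4 order_trans add_mono by meson
  qed (use B in simp)
qed

lemma pair_integrable_bounded:
  fixes f :: "complex \<times> complex \<Rightarrow> complex"
  assumes "f \<in> borel_measurable (borel \<Otimes>\<^sub>M borel)" "\<And>z u. z \<in> C \<Longrightarrow> u \<in> C \<Longrightarrow> norm (f (z, u)) \<le> B"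
  shows "integrable (M \<Otimes>\<^sub>M M) f"
proof -
  interpret P: pair_sigma_finite M M ..
  interpret PF: finite_measure "M \<Otimes>\<^sub>M M"
    by (intro finite_measure_pair_measure finite_measure_axioms)
  have [measurable]: "C \<in> sets borel" 
    using compact_C by (simp add: borel_compact)
  have "AE p in M \<Otimes>\<^sub>M M. fst p \<in> C \<and> snd p \<in> C"
    by (intro P.AE_pair_measure) (use AE_C in auto)
  hence "AE p in M \<Otimes>\<^sub>M M. norm (f p) \<le> B"
    by eventually_elim (use assms(2) in auto)
  moreover have "f \<in> borel_measurable (M \<Otimes>\<^sub>M M)"
    using assms(1) by measurable
  ultimately show ?thesis by (intro PF.integrable_const_bound)
qed

text \<open>The quotient \<open>conj_diffs c m z u / (u - z)\<close> is continuous across the diagonal, which carries the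
  vanishing of its integral from \<open>G\<close> to the boundary, without boundary values of
  Cauchy integrals.\<close>

lemma integral_conj_diffs_quotient_eq_0:
  assumes orth: "\<And>l n. l \<in> G \<Longrightarrow> (\<integral>z. cnj (z - c) ^ n / (z - l) \<partial>M) = 0"
    and disj: "G \<inter> C = {}" and m: "1 \<le> m" and z: "z \<in> closure G"
  shows "(\<integral>u. conj_diffs c m z u / (u - z) \<partial>M) = 0"
proof -
  have int: "integrable M (\<lambda>u. cnj (u - c) ^ n / (u - l))" if "l \<in> G" for n l
    by (rule integrable_continuous)
      (use disj that in \<open>auto intro!: continuous_on_divide continuous_on_power continuous_on_cnj continuous_on_diff\<close>)
  have G: "(\<integral>u. conj_diffs c m l u / (u - l) \<partial>M) = 0" if l: "l \<in> G" for l
  proof -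
    \<comment> \<open>For fixed \<open>l\<close> the numerator is a combination of powers of
      \<open>cnj (u - c)\<close> with coefficients free of \<open>u\<close>, so each summand
      integrates to zero by \<open>orth\<close>.\<close>
    have "conj_diffs c m l u / (u - l) =
      cnj (l - c) ^ Suc m * (cnj (u - c) ^ 0 / (u - l)) - cnj (l - c) * (cnj (u - c) ^ m / (u - l))
      - cnj (l - c) ^ m * (cnj (u - c) ^ 1 / (u - l)) + cnj (u - c) ^ Suc m / (u - l)" for u
    proof -
      show ?thesis unfolding conj_diffs_alt
        by (simp add: diff_divide_distrib add_divide_distrib algebra_simps del: complex_cnj_diff)
    qed
    thus ?thesis
      by (simp only: Bochner_Integration.integral_add Bochner_Integration.integral_diff
          integrable_mult_right Bochner_Integration.integrable_diff int[OF l] orth[OF l] integral_mult_right_zero) simp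
  qed
  obtain l where l: "\<And>n. l n \<in> G" "l \<longlonglongrightarrow> z"
    using z unfolding closure_sequential by blast
  \<comment> \<open>A common bound for the powers on the sequence and on \<open>C\<close> dominates
    all the quotients, by \<open>norm_conj_diffs_quotient_le\<close>.\<close>
  have "bounded (range l)"
    using l(2) convergent_imp_bounded by blast
  hence "bounded (range l \<union> C)"
    using compact_C by (simp add: compact_imp_bounded)
  hence "bounded ((\<lambda>z. cnj (z - c) ^ m) ` closure (range l \<union> C))"
    by (intro compact_imp_bounded compact_continuous_image continuous_intros) (simp only: compact_closure)
  then obtain B where B: "\<And>z. z \<in> range l \<union> C \<Longrightarrow> norm (cnj (z - c) ^ m) \<le> B"
    unfolding bounded_iff by (meson closure_subset imageI subsetD)
  have "(\<lambda>n. \<integral>u. conj_diffs c m (l n) u / (u - l n) \<partial>M) \<longlonglongrightarrow> (\<integral>u. conj_diffs c m z u / (u - z) \<partial>M)"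
  proof (rule integral_dominated_convergence)
    show "AE u in M. (\<lambda>n. conj_diffs c m (l n) u / (u - l n)) \<longlonglongrightarrow> conj_diffs c m z u / (u - z)"
      by (intro AE_I2 tendsto_conj_diffs_quotient m l)
    show "AE u in M. norm (conj_diffs c m (l n) u / (u - l n)) \<le> B + B" for n
      using AE_C
    proof eventually_elim
      fix u assume "u \<in> C"
      have "norm (cnj (l n - c) ^ m - cnj (u - c) ^ m) \<le> norm (cnj (l n - c) ^ m) + norm (cnj (u - c) ^ m)"
        by (rule norm_triangle_ineq4)
      also have "\<dots> \<le> B + B"
        by (intro add_mono B) (use \<open>u \<in> C\<close> in auto)
      finally show "norm (conj_diffs c m (l n) u / (u - l n)) \<le> B + B"
        using norm_conj_diffs_quotient_le order_trans by blast
    qed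
  qed (auto simp: conj_diffs_def)
  thus ?thesis using G[OF l(1)] by (simp add: LIMSEQ_const_iff)
qed

text \<open>The inner integral of \<open>q\<close> vanishes for every \<open>z\<close> in
  \<open>C\<close>, since \<open>C\<close> lies in \<open>closure G\<close>. So the double integral
  of \<open>q\<close> is zero, also with the variables exchanged. In the sum of both, the singular
  quotient turns into the divided difference of the \<open>k\<close>-th power, a polynomial, so that
  only moments remain.\<close>

lemma double_integral_conj_diffs_eq_0:
  assumes orth: "\<And>l n. l \<in> G \<Longrightarrow> (\<integral>z. cnj (z - c) ^ n / (z - l) \<partial>M) = 0"
    and G: "G \<inter> C = {}" "C \<subseteq> closure G" and m: "1 \<le> m"
  shows "(\<integral>z. \<integral>u. conj_diffs c m z u * (\<Sum>i<k. (z - c) ^ i * (u - c) ^ (k - Suc i)) \<partial>M \<partial>M) = 0"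
proof -
  interpret P: pair_sigma_finite M M ..
  define q where "q z u = (z - c) ^ k * (conj_diffs c m z u / (u - z))" for z u
  obtain B where B: "0 \<le> B" "\<And>z u. z \<in> C \<Longrightarrow> u \<in> C \<Longrightarrow> norm (cnj (z - c) ^ m - cnj (u - c) ^ m) \<le> B"
    using bounded_powers[of c m] by metis
  have "bounded ((\<lambda>z. (z - c) ^ k) ` C)"
    by (intro compact_imp_bounded compact_continuous_image continuous_intros compact_C)
  then obtain A where A: "\<And>z. z \<in> C \<Longrightarrow> norm ((z - c) ^ k) \<le> A" "0 < A"
    unfolding bounded_pos by auto
  have qmeas: "(\<lambda>p. q (fst p) (snd p)) \<in> borel_measurable (borel \<Otimes>\<^sub>M borel)"
    unfolding q_def conj_diffs_def by measurable
  have qint: "integrable (M \<Otimes>\<^sub>M M) (\<lambda>p. q (fst p) (snd p))"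
  proof (rule pair_integrable_bounded[OF qmeas])
    fix z u assume "z \<in> C" "u \<in> C"
    thus "norm (q (fst (z, u)) (snd (z, u))) \<le> A * B"
      unfolding q_def norm_mult[of "_ ^ k"] fst_conv snd_conv
      by (intro mult_mono A order_trans[OF norm_conj_diffs_quotient_le B(2)]) (use A in auto)
  qed
  have qint': "integrable (M \<Otimes>\<^sub>M M) (\<lambda>p. q (snd p) (fst p))"
    using P.integrable_product_swap[OF qint] by (simp add: case_prod_unfold)
  have "(\<integral>p. q (fst p) (snd p) \<partial>(M \<Otimes>\<^sub>M M)) = (\<integral>z. \<integral>u. q z u \<partial>M \<partial>M)"
    using P.integral_fst'[OF qint] by simp
  also have "\<dots> = (\<integral>z. 0 \<partial>M)"
  proof (rule integral_cong_AE)
    show "AE z in M. (\<integral>u. q z u \<partial>M) = 0"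
      using AE_C
    proof eventually_elim
      fix z assume "z \<in> C"
      thus "(\<integral>u. q z u \<partial>M) = 0"
        unfolding q_def integral_mult_right_zero
          using integral_conj_diffs_quotient_eq_0[OF orth G(1) m, of z] G(2) by auto
    qed
    show "(\<lambda>z. \<integral>u. q z u \<partial>M) \<in> borel_measurable M"
      using P.integrable_fst'[OF qint] by simp
  qed simp
  finally have 0: "(\<integral>p. q (fst p) (snd p) \<partial>(M \<Otimes>\<^sub>M M)) = 0" by simp
  have "(\<integral>p. q (snd p) (fst p) \<partial>(M \<Otimes>\<^sub>M M)) = 0"
    using P.integral_product_swap[OF borel_measurable_integrable[OF qint]] 0
    by (simp add: case_prod_unfold)
  \<comment> \<open>As \<open>conj_diffs\<close> is symmetric, symmetrising \<open>q\<close> makes the denominator divide \<open>(z - c)^k - (u - c)^k\<close>.\<close>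
  hence "(\<integral>p. - (q (fst p) (snd p) + q (snd p) (fst p)) \<partial>(M \<Otimes>\<^sub>M M)) = 0"
    using 0 qint qint' by simp
  also have "(\<lambda>p. - (q (fst p) (snd p) + q (snd p) (fst p))) = 
    (\<lambda>p. conj_diffs c m (fst p) (snd p) * (\<Sum>i<k. (fst p - c) ^ i * (snd p - c) ^ (k - Suc i)))"
    (is "?l = ?r")
  proof
    fix p :: "complex \<times> complex"
    obtain z u where p: "p = (z, u)" by (cases p)
    show "?l p = ?r p"
    proof (cases "z = u")
      case True
      thus ?thesis by (simp add: p q_def)
    next
      case False
      have "(z - c) ^ k - (u - c) ^ k = (z - u) * (\<Sum>i<k. (z - c) ^ i * (u - c) ^ (k - Suc i))"
        using power_diff_sumr2[of "z - c" k "u - c"] by (simp add: mult.commute)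
      moreover have "A * (X / (u - z)) + B * (X / (z - u)) = - (X * ((A - B) / (z - u)))" for A B X
      proof -
        have "X / (u - z) = - (X / (z - u))"
          by (metis divide_minus_right minus_diff_eq)
        thus ?thesis by (simp add: algebra_simps diff_divide_distrib)
      qed
      hence "q z u + q u z = - (conj_diffs c m z u * (((z - c) ^ k - (u - c) ^ k) / (z - u)))"
        unfolding q_def conj_diffs_commute[of c m u z] .
      ultimately show ?thesis using False by (simp add: p)
    qed
  qed
  finally have e: "integral\<^sup>L (M \<Otimes>\<^sub>M M) ?r = 0" .
  have "integrable (M \<Otimes>\<^sub>M M) ?l" using qint qint' by simp
  hence "integrable (M \<Otimes>\<^sub>M M) ?r" by (simp only: \<open>?l = ?r\<close>)
  from P.integral_fst'[OF this] e show ?thesis by simp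
qed

text \<open>For \<open>k = 1\<close> the double integral is \<open>2 * (moment c 0 (Suc m) * moment
  c 0 0 - moment c 0 1 * moment c 0 m)\<close>, whose second product vanishes by \<open>c\<close>.
  For \<open>m = 1\<close>, \<open>k = 3\<close> all products have total bidegree (2, 2), and each
  one except \<open>moment c 2 2 * moment c 0 0\<close> and \<open>moment c 1 1 ^ 2\<close> has a
  factor already known to be zero.\<close>

lemma
  assumes orth: "\<And>l n. l \<in> G \<Longrightarrow> (\<integral>z. cnj (z - c) ^ n / (z - l) \<partial>M) = 0"
    and G: "G \<inter> C = {}" "C \<subseteq> closure G"
    and c: "moment c 0 1 = 0" and M0: "moment c 0 0 \<noteq> 0"
  shows moment_0_eq_0: "1 \<le> m \<Longrightarrow> moment c 0 m = 0"
    and moment_2_2: "moment c 2 2 * moment c 0 0 = moment c 1 1 ^ 2"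
proof -
  let ?I = "\<lambda>i j u. (u - c) ^ i * cnj (u - c) ^ j"
  have m: "(\<integral>u. ?I i j u \<partial>M) = moment c i j" for i j
    by (simp only: moment_def)
  note int = integrable_moment[of c]
  note eval = Bochner_Integration.integral_add Bochner_Integration.integral_diff
          integrable_mult_right Bochner_Integration.integrable_diff Bochner_Integration.integrable_add
          integrable_mult_left integral_mult_right_zero integral_mult_left_zero m int
  have step: "moment c 0 (Suc m) = 0" if "1 \<le> m" for m
  proof -
    have "(\<integral>z. \<integral>u. conj_diffs c m z u * 1 \<partial>M \<partial>M) = 0"
      using double_integral_conj_diffs_eq_0[OF orth G that, of 1] by simp
    also have "(\<lambda>z u. conj_diffs c m z u * 1) = (\<lambda>z u. ?I 0 (Suc m) z * ?I 0 0 u - ?I 0 1 z * ?I 0 m u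
        - ?I 0 m z * ?I 0 1 u + ?I 0 0 z * ?I 0 (Suc m) u)"
      unfolding conj_diffs_alt by (intro ext) (simp add: algebra_simps del: complex_cnj_diff)
    also have "(\<integral>z. \<integral>u. ?I 0 (Suc m) z * ?I 0 0 u - ?I 0 1 z * ?I 0 m u
        - ?I 0 m z * ?I 0 1 u + ?I 0 0 z * ?I 0 (Suc m) u \<partial>M \<partial>M) =
        moment c 0 (Suc m) * moment c 0 0 - moment c 0 1 * moment c 0 m - moment c 0 m * moment c 0 1
        + moment c 0 0 * moment c 0 (Suc m)"
      by (simp only: eval)
    finally show ?thesis using c M0 by simp
  qed
  show m0: "moment c 0 m = 0" if "1 \<le> m" for m
    using that c step[of "m - 1"] by (cases "m = 1") auto
  have c': "moment c 1 0 = 0" using moment_commute[of c 1 0] c by simp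
  have e3: "(\<Sum>i<3. a ^ i * b ^ (3 - Suc i)) = a\<^sup>2 + a * b + b\<^sup>2" for a b :: complex
    by (simp add: numeral_3_eq_3 numeral_2_eq_2)
  \<comment> \<open>Exponents 0 and 1 stay unsimplified so that every product consists of two
    literal moment integrands, one in each variable.\<close>
  have expand: "(p - q) * (p ^ 1 - q ^ 1) * (a\<^sup>2 + a * b + b\<^sup>2) =
    a ^ 2 * p ^ 2 * (b ^ 0 * q ^ 0) + a ^ 1 * p ^ 2 * (b ^ 1 * q ^ 0) + a ^ 0 * p ^ 2 * (b ^ 2 * q ^ 0)
      - 2 * (a ^ 2 * p ^ 1 * (b ^ 0 * q ^ 1)) - 2 * (a ^ 1 * p ^ 1 * (b ^ 1 * q ^ 1))
      - 2 * (a ^ 0 * p ^ 1 * (b ^ 2 * q ^ 1))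
      + a ^ 2 * p ^ 0 * (b ^ 0 * q ^ 2) + a ^ 1 * p ^ 0 * (b ^ 1 * q ^ 2) + a ^ 0 * p ^ 0 * (b ^ 2 * q ^ 2)"
    for a b p q :: complex
    by (simp add: algebra_simps power2_eq_square)
  have "(\<integral>z. \<integral>u. conj_diffs c 1 z u * (\<Sum>i<3. (z - c) ^ i * (u - c) ^ (3 - Suc i)) \<partial>M \<partial>M) = 0"
    using double_integral_conj_diffs_eq_0[OF orth G, of 1 3] by simp
  also have "(\<lambda>z u. conj_diffs c 1 z u * (\<Sum>i<3. (z - c) ^ i * (u - c) ^ (3 - Suc i))) =
     (\<lambda>z u. ?I 2 2 z * ?I 0 0 u + ?I 1 2 z * ?I 1 0 u + ?I 0 2 z * ?I 2 0 u
       - 2 * (?I 2 1 z * ?I 0 1 u) - 2 * (?I 1 1 z * ?I 1 1 u) - 2 * (?I 0 1 z * ?I 2 1 u)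
       + ?I 2 0 z * ?I 0 2 u + ?I 1 0 z * ?I 1 2 u + ?I 0 0 z * ?I 2 2 u)"
    unfolding conj_diffs_alt e3 by (intro ext, rule expand)
  also have "(\<integral>z. \<integral>u. ?I 2 2 z * ?I 0 0 u + ?I 1 2 z * ?I 1 0 u + ?I 0 2 z * ?I 2 0 u
       - 2 * (?I 2 1 z * ?I 0 1 u) - 2 * (?I 1 1 z * ?I 1 1 u) - 2 * (?I 0 1 z * ?I 2 1 u)
       + ?I 2 0 z * ?I 0 2 u + ?I 1 0 z * ?I 1 2 u + ?I 0 0 z * ?I 2 2 u \<partial>M \<partial>M) =
       moment c 2 2 * moment c 0 0 + moment c 1 2 * moment c 1 0 + moment c 0 2 * moment c 2 0
       - 2 * (moment c 2 1 * moment c 0 1) - 2 * (moment c 1 1 * moment c 1 1)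
       - 2 * (moment c 0 1 * moment c 2 1) + moment c 2 0 * moment c 0 2
       + moment c 1 0 * moment c 1 2 + moment c 0 0 * moment c 2 2"
    by (simp only: eval)
  finally show "moment c 2 2 * moment c 0 0 = moment c 1 1 ^ 2"
    using c c' m0[of 2] by (simp add: power2_eq_square mult.commute)
qed

text \<open>The identity is the equality case of Cauchy-Schwarz for \<open>norm (u - c) ^ 2\<close>
  and 1: the variance of \<open>norm (u - c) ^ 2\<close> about its mean \<open>R\<close> is zero.
  Radius 0 is still possible here.\<close>

lemma concentrated_on_circle:
  assumes M0: "moment c 0 0 \<noteq> 0" and m22: "moment c 2 2 * moment c 0 0 = moment c 1 1 ^ 2"
  shows "\<exists>r\<ge>0. AE z in M. dist c z = r"
proof -
  define S where "S k = (\<integral>u. norm (u - c) ^ (2 * k) \<partial>M)" for k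
  have int: "integrable M (\<lambda>u. norm (u - c) ^ (2 * k))" for k
    by (rule integrable_continuous) (auto intro!: continuous_intros)
  have S: "moment c k k = of_real (S k)" for k
  proof -
    have "x ^ k * cnj x ^ k = complex_of_real (norm x ^ (2 * k))" for x
      by (metis complex_norm_square of_real_power power_mult power_mult_distrib)
    thus ?thesis
      unfolding S_def moment_def by (simp only: integral_complex_of_real)
  qed
  have S0: "S 0 \<noteq> 0" using M0 S[of 0] by simp
  have S2: "S 2 * S 0 = S 1 ^ 2"
    using m22 unfolding S by (simp flip: of_real_mult of_real_power)
  define R where "R = S 1 / S 0"
  have S00: "0 \<le> S k" for k unfolding S_def by (intro Bochner_Integration.integral_nonneg) simp
  have R0: "0 \<le> R" unfolding R_def using S00 by simp
  have "(\<integral>u. (norm (u - c) ^ 2 - R) ^ 2 \<partial>M) =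
    (\<integral>u. norm (u - c) ^ (2*2) - 2 * R * norm (u - c) ^ (2*1) + R^2 * norm (u - c) ^ (2*0) \<partial>M)"
    by (intro Bochner_Integration.integral_cong) (auto simp: power2_eq_square algebra_simps eval_nat_numeral)
  also have "\<dots> = S 2 - 2 * R * S 1 + R^2 * S 0"
    by (simp only: Bochner_Integration.integral_add Bochner_Integration.integral_diff
          integrable_mult_right Bochner_Integration.integrable_diff int integral_mult_right_zero S_def)
  also have "\<dots> = 0"
    using S0 S2 by (simp add: R_def field_simps power2_eq_square)
  finally have z: "(\<integral>u. (norm (u - c) ^ 2 - R) ^ 2 \<partial>M) = 0" .
  have "integrable M (\<lambda>u. (norm (u - c) ^ 2 - R) ^ 2)"
    by (rule integrable_continuous) (auto intro!: continuous_intros)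
  hence "AE u in M. (norm (u - c) ^ 2 - R) ^ 2 = 0"
    using z by (subst (asm) integral_nonneg_eq_0_iff_AE) auto
  hence "AE u in M. dist c u = sqrt R"
    by eventually_elim (auto simp: dist_norm norm_minus_commute intro!: real_sqrt_unique[symmetric])
  thus ?thesis using R0 by (intro exI[of _ "sqrt R"]) auto
qed

end


section \<open>Measures on a circle with vanishing moments\<close>

text \<open>Since \<open>cnj (z - c) = r\<^sup>2 / (z - c)\<close> on the circle, the real polynomial functions are Laurent
  polynomials there.\<close>

lemma real_polynomial_function_circle:
  fixes f :: "complex \<Rightarrow> real"
  assumes "real_polynomial_function f" "0 < r"
  shows "\<exists>p N. \<forall>z. dist c z = r \<longrightarrow> of_real (f z) = poly p (z - c) / (z - c) ^ N"
  using assms(1)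
proof induction
  case (linear f)
  interpret bounded_linear f by fact
  \<comment> \<open>With \<open>a = z - c\<close> on the circle,
    \<open>Re a = (a + r^2 / a) / 2\<close> and \<open>Im a = - \<i> * (a - r^2 / a) / 2\<close>.
    The coefficients are those of \<open>a * f z\<close>, where
    \<open>f z = Re a * f 1 + Im a * f \<i> + f c\<close>.\<close>
  define p where "p = [: of_real (r^2 / 2) * (f 1 + \<i> * f \<i>), of_real (f c), of_real (1/2) * (f 1 - \<i> * f \<i>) :]"
  have "of_real (f z) = poly p (z - c) / (z - c) ^ 1" if z: "dist c z = r" for z
  proof -
    define a where "a = z - c"
    have "norm a = r" using z by (simp add: a_def dist_norm norm_minus_commute)
    hence a: "a * cnj a = of_real (r^2)" "a \<noteq> 0"
      using \<open>0 < r\<close> by (auto simp flip: complex_norm_square)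
    have "f z = f a + f c" by (simp add: a_def diff)
    also have "f a = f (Re a *\<^sub>R 1 + Im a *\<^sub>R \<i>)"
      by (metis complex_eq mult.commute scaleR_conv_of_real mult.right_neutral)
    also have "\<dots> = Re a * f 1 + Im a * f \<i>" by (simp only: add scale real_scaleR_def)
    finally have "f z = Re a * f 1 + Im a * f \<i> + f c" by simp
    hence fz: "complex_of_real (f z) =
        of_real (Re a) * of_real (f 1) + of_real (Im a) * of_real (f \<i>) + of_real (f c)"
      by (metis of_real_add of_real_mult)
    have Re: "complex_of_real (Re a) = (a + cnj a) / 2"
      by (simp add: complex_add_cnj)
    have Im: "complex_of_real (Im a) = - \<i> * (a - cnj a) / 2"
      by (simp add: complex_eq_iff)
    have "a * complex_of_real (f z) = ((a * a + a * cnj a) / 2) * f 1 - \<i> * (a * a - a * cnj a) / 2 * f \<i> + a * f c"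
      unfolding fz Re Im by (simp add: field_simps)
    also have "\<dots> = poly p a"
      unfolding a(1) p_def by (simp add: algebra_simps add_divide_distrib diff_divide_distrib)
    finally show ?thesis using a(2) by (simp add: a_def[symmetric] field_simps)
  qed
  thus ?case by blast
next
  case (const k)
  show ?case by (rule exI[of _ "[:of_real k:]"], rule exI[of _ 0]) simp
next
  case (add f g)
  then obtain p N q K where *: "\<And>z. dist c z = r \<Longrightarrow> of_real (f z) = poly p (z - c) / (z - c) ^ N"
    "\<And>z. dist c z = r \<Longrightarrow> of_real (g z) = poly q (z - c) / (z - c) ^ K"
    by blast
  have "of_real (f z + g z) = poly (p * monom 1 K + q * monom 1 N) (z - c) / (z - c) ^ (N + K)"
    if "dist c z = r" for z
  proof -
    have "z - c \<noteq> 0" using that \<open>0 < r\<close> by auto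
    thus ?thesis using *[OF that] by (simp add: poly_monom power_add field_simps)
  qed
  thus ?case by blast
next
  case (mult f g)
  then obtain p N q K where *: "\<And>z. dist c z = r \<Longrightarrow> of_real (f z) = poly p (z - c) / (z - c) ^ N"
    "\<And>z. dist c z = r \<Longrightarrow> of_real (g z) = poly q (z - c) / (z - c) ^ K"
    by blast
  have "of_real (f z * g z) = poly (p * q) (z - c) / (z - c) ^ (N + K)" if "dist c z = r" for z
    using *[OF that] by (simp add: power_add)
  thus ?case by blast
qed

text \<open>The last assumption says that the Fourier coefficients of nonzero order vanish, those of
  negative order by conjugation. Hence these are the multiples of arc length on the circle, the zero
  measure included.\<close>

locale circle_measure = finite_measure M for M :: "complex measure" +
  fixes c :: complex and r :: real
  assumes sets_M [measurable_cong]: "sets M = sets borel"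
    and AE_circle: "AE z in M. dist c z = r"
    and r_pos: "0 < r"
    and power_integral: "\<And>n. 0 < n \<Longrightarrow> (\<integral>z. (z - c) ^ n \<partial>M) = 0"
begin

sublocale planar_compact_measure M "sphere c r"
  by unfold_locales (use sets_M AE_circle in auto)

lemma cnj_power_integral:
  assumes "0 < n" shows "(\<integral>z. cnj (z - c) ^ n \<partial>M) = 0"
proof -
  have "(\<integral>z. cnj ((z - c) ^ n) \<partial>M) = 0"
    unfolding Bochner_Integration.integral_cnj power_integral[OF assms] by simp
  thus ?thesis by simp
qed

text \<open>On the circle \<open>1 / (z - c)\<close> equals \<open>cnj (z - c) / r^2\<close>, so
  negative powers are conjugate moments.\<close>

lemma Laurent_monomial_integral:
  "(\<integral>z. (z - c) ^ i / (z - c) ^ N \<partial>M) = (if i = N then of_real (measure M (space M)) else 0)"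
proof -
  have ne: "AE z in M. z \<noteq> c" using AE_circle by eventually_elim (use r_pos in auto)
  consider "i = N" | "i > N" | "i < N" by linarith
  thus ?thesis
  proof cases
    case 1
    have "(\<integral>z. (z - c) ^ i / (z - c) ^ N \<partial>M) = (\<integral>z. 1 \<partial>M)"
    proof (rule integral_cong_AE)
      show "AE z in M. (z - c) ^ i / (z - c) ^ N = 1"
        using ne by eventually_elim (use 1 in auto)
    qed auto
    also have "\<dots> = of_real (measure M (space M))"
      by (simp add: scaleR_conv_of_real)
    finally show ?thesis using 1 by simp
  next
    case 2
    have "(\<integral>z. (z - c) ^ i / (z - c) ^ N \<partial>M) = (\<integral>z. (z - c) ^ (i - N) \<partial>M)"
    proof (rule integral_cong_AE)
      show "AE z in M. (z - c) ^ i / (z - c) ^ N = (z - c) ^ (i - N)"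
        using ne by eventually_elim (use 2 in \<open>auto simp: power_diff\<close>)
    qed auto
    thus ?thesis using 2 power_integral by simp
  next
    case 3
    have "(\<integral>z. (z - c) ^ i / (z - c) ^ N \<partial>M) = (\<integral>z. of_real (1 / r ^ (2 * (N - i))) * cnj (z - c) ^ (N - i) \<partial>M)"
    proof (rule integral_cong_AE)
      show "AE z in M. (z - c) ^ i / (z - c) ^ N = of_real (1 / r ^ (2 * (N - i))) * cnj (z - c) ^ (N - i)"
        using AE_circle
      proof eventually_elim
        fix z assume z: "dist c z = r"
        define a where "a = z - c"
        have "norm a = r" using z by (simp add: a_def dist_norm norm_minus_commute)
        hence a: "a * cnj a = of_real (r^2)" "a \<noteq> 0"
          using r_pos by (auto simp flip: complex_norm_square)
        have "(a * cnj a) ^ (N - i) = of_real (r ^ (2 * (N - i)))"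
          unfolding a(1) by (simp add: power_mult)
        moreover have "a ^ N = a ^ i * a ^ (N - i)" using 3 by (simp flip: power_add)
        ultimately show "(z - c) ^ i / (z - c) ^ N = of_real (1 / r ^ (2 * (N - i))) * cnj (z - c) ^ (N - i)"
          unfolding a_def[symmetric] using a(2) r_pos by (simp add: field_simps power_mult_distrib)
      qed
    qed measurable
    thus ?thesis using 3 by (simp only: integral_mult_right_zero) (simp add: cnj_power_integral del: complex_cnj_diff)
  qed
qed

lemma integral_Laurent_polynomial:
  "(\<integral>z. poly p (z - c) / (z - c) ^ N \<partial>M) = coeff p N * of_real (measure M (space M))"
proof -
  have int: "integrable M (\<lambda>z. (z - c) ^ i / (z - c) ^ N)" for i
    by (rule integrable_continuous) (use r_pos in \<open>auto intro!: continuous_intros\<close>)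
  have "poly p (z - c) / (z - c) ^ N = (\<Sum>i\<le>degree p. coeff p i * ((z - c) ^ i / (z - c) ^ N))" for z
    by (simp add: poly_altdef sum_divide_distrib)
  hence "(\<integral>z. poly p (z - c) / (z - c) ^ N \<partial>M) = (\<Sum>i\<le>degree p. coeff p i * (\<integral>z. (z - c) ^ i / (z - c) ^ N \<partial>M))"
    by (simp only: Bochner_Integration.integral_sum integrable_mult_right int integral_mult_right_zero)
  also have "\<dots> = (\<Sum>i\<le>degree p. if i = N then coeff p N * of_real (measure M (space M)) else 0)"
    by (intro sum.cong) (auto simp: Laurent_monomial_integral)
  also have "\<dots> = coeff p N * of_real (measure M (space M))"
    by (auto simp: coeff_eq_0)
  finally show ?thesis .
qed

end

text \<open>The indicator of a closed set is the limit of continuous functions that fall off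
  linearly with the distance, ever more steeply, and the closed sets form an intersection-stable
  generator.\<close>

lemma finite_measure_eqI_continuous:
  fixes M N :: "'a::metric_space measure"
  assumes M: "finite_measure M" "sets M = sets borel" and N: "finite_measure N" "sets N = sets borel"
    and eq: "\<And>f :: 'a \<Rightarrow> real. continuous_on UNIV f \<Longrightarrow> (\<And>x. 0 \<le> f x \<and> f x \<le> 1) \<Longrightarrow>
       (\<integral>x. f x \<partial>M) = (\<integral>x. f x \<partial>N)"
  shows "M = N"
proof -
  have closed: "measure M F = measure N F" if F: "closed F" for F
  \<comment> \<open>By convention \<open>infdist x {} = 0\<close>, which would make the functions
    \<open>g k\<close> constantly 1 for empty \<open>F\<close>.\<close>
  proof (cases "F = {}")
    case False
    define g where "g k x = max 0 (1 - real k * infdist x F)" for k x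
    have g: "continuous_on UNIV (g k)" "0 \<le> g k x \<and> g k x \<le> 1" for k x
      unfolding g_def by (auto intro!: continuous_intros simp: infdist_nonneg)
    have lim: "(\<lambda>k. g k x) \<longlonglongrightarrow> indicator F x" for x
    proof (cases "x \<in> F")
      case True
      thus ?thesis using F False by (simp add: g_def)
    next
      case False
      hence d: "0 < infdist x F" using F \<open>F \<noteq> {}\<close>
        by (metis in_closed_iff_infdist_zero infdist_nonneg order_less_le)
      obtain K :: nat where K: "1 / infdist x F < K" using reals_Archimedean2 by blast
      have "eventually (\<lambda>k. g k x = 0) sequentially"
        using eventually_ge_at_top[of K]
      proof eventually_elim
        fix k assume "K \<le> k"
        hence "1 / infdist x F < real k" using K by linarith
        thus "g k x = 0" using d by (simp add: g_def field_simps)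
      qed
      thus ?thesis using False by (simp add: tendsto_eventually)
    qed
    have conv: "(\<lambda>k. \<integral>x. g k x \<partial>L) \<longlonglongrightarrow> measure L F"
      if L: "finite_measure L" "sets L = sets borel" for L
    proof -
      interpret finite_measure L by fact
      have [measurable]: "g k \<in> borel_measurable L" for k
        using L(2) borel_measurable_continuous_onI[OF g(1)] by (simp cong: measurable_cong_sets)
      have [measurable]: "F \<in> sets L" using F L by simp
      have "(\<lambda>k. \<integral>x. g k x \<partial>L) \<longlonglongrightarrow> (\<integral>x. indicator F x \<partial>L)"
        by (rule integral_dominated_convergence[where w = "\<lambda>_. 1"])
          (use lim g(2) in \<open>auto simp: abs_le_iff\<close>)
      thus ?thesis by (simp add: sets.Int_space_eq1)
    qed
    show ?thesis
      using LIMSEQ_unique[OF conv[OF M]] conv[OF N] eq[OF g] by simp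
  qed simp
  show ?thesis
  proof (rule measure_eqI_generator_eq[where A = "\<lambda>_. UNIV" and \<Omega> = UNIV and E = "Collect closed"])
    show "Int_stable (Collect closed)" by (auto simp: Int_stable_def)
    show "sets M = sigma_sets UNIV (Collect closed)" "sets N = sigma_sets UNIV (Collect closed)"
      using M N by (simp_all add: borel_eq_closed)
    show "emeasure M X = emeasure N X" if "X \<in> Collect closed" for X
      using that closed M(1) N(1) by (simp add: finite_measure.emeasure_eq_measure)
    show "emeasure M UNIV \<noteq> \<infinity>" for i :: nat
      using M(1) by (simp add: finite_measure.emeasure_finite)
  qed auto
qed

text \<open>By Stone-Weierstrass a continuous function is uniformly close on the circle to real
  polynomials. These are Laurent polynomials there, and the integral of a Laurent polynomial depends
  on the measure only through its mass.\<close>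

lemma circle_measure_unique:
  assumes "circle_measure M c r" "circle_measure N c r"
    and mass: "measure M (space M) = measure N (space N)"
  shows "M = N"
proof -
  interpret M: circle_measure M c r by fact
  interpret N: circle_measure N c r by fact
  show ?thesis
  proof (rule finite_measure_eqI_continuous)
    fix f :: "complex \<Rightarrow> real"
    assume f: "continuous_on UNIV f"
    hence fS: "continuous_on (sphere c r) f" using continuous_on_subset by blast
    have fm: "f \<in> borel_measurable borel" using f by (rule borel_measurable_continuous_onI)
    define m where "m = measure M (space M)"
    have close: "\<exists>p. real_polynomial_function p \<and> \<bar>(\<integral>x. f x \<partial>M) - (\<integral>x. p x \<partial>M)\<bar> \<le> e * m
      \<and> \<bar>(\<integral>x. f x \<partial>N) - (\<integral>x. p x \<partial>N)\<bar> \<le> e * m" if "0 < e" for e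
    proof -
      obtain p where p: "real_polynomial_function p" "\<And>x. x \<in> sphere c r \<Longrightarrow> \<bar>f x - p x\<bar> < e"
        using Stone_Weierstrass_real_polynomial_function[OF compact_sphere fS \<open>0 < e\<close>] by blast
      have pc: "continuous_on A p" for A
        using p(1) by (intro continuous_on_polymonial_function) (simp add: real_polynomial_function_eq)
      have pm: "p \<in> borel_measurable borel" by (rule borel_measurable_continuous_onI[OF pc])
      have "\<bar>(\<integral>x. f x \<partial>L) - (\<integral>x. p x \<partial>L)\<bar> \<le> e * m"
        if L: "circle_measure L c r" "measure L (space L) = m" for L
      proof -
        interpret L: circle_measure L c r by fact
        note i = L.integrable_continuous[OF fm fS] L.integrable_continuous[OF pm pc]
        have "\<bar>\<integral>x. f x - p x \<partial>L\<bar> \<le> (\<integral>x. \<bar>f x - p x\<bar> \<partial>L)"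
          by (rule integral_abs_bound)
        also have "\<dots> \<le> (\<integral>x. e \<partial>L)"
        proof (rule integral_mono_AE)
          show "AE x in L. \<bar>f x - p x\<bar> \<le> e"
            using L.AE_circle by eventually_elim (use p(2) in \<open>force intro: less_imp_le\<close>)
        qed (use i in auto)
        finally show ?thesis using i L(2) by (simp add: mult.commute)
      qed
      from this[OF assms(1)] this[OF assms(2)] mass p(1) show ?thesis
        by (auto simp: m_def)
    qed
    have peq: "(\<integral>x. p x \<partial>M) = (\<integral>x. p x \<partial>N)" if p: "real_polynomial_function p" for p
    proof -
      obtain q K where q: "\<And>z. dist c z = r \<Longrightarrow> of_real (p z) = poly q (z - c) / (z - c) ^ K"
        using real_polynomial_function_circle[OF p M.r_pos] by blast
      have pm: "p \<in> borel_measurable borel" 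
        using p by (intro borel_measurable_continuous_onI continuous_on_polymonial_function) 
         (simp add: real_polynomial_function_eq)
      have "complex_of_real (\<integral>x. p x \<partial>L) = coeff q K * of_real (measure L (space L))"
        if "circle_measure L c r" for L
      proof -
        interpret L: circle_measure L c r by fact
        have [measurable]: "p \<in> borel_measurable L"
          using pm by (simp add: L.sets_M cong: measurable_cong_sets)
        have "(\<integral>x. complex_of_real (p x) \<partial>L) = (\<integral>z. poly q (z - c) / (z - c) ^ K \<partial>L)"
        proof (rule integral_cong_AE)
          show "AE x in L. complex_of_real (p x) = poly q (x - c) / (x - c) ^ K"
            using L.AE_circle by eventually_elim (rule q)
          have "poly q \<in> borel_measurable borel" 
            by (intro borel_measurable_continuous_onI continuous_intros)
          from measurable_compose[OF _ this] 
          show "(\<lambda>x. poly q (x - c) / (x - c) ^ K) \<in> borel_measurable L" by measurable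
        qed measurable
        thus ?thesis by (simp add: L.integral_Laurent_polynomial)
      qed
      from this[OF assms(1)] this[OF assms(2)] mass show ?thesis
        by (metis of_real_eq_iff)
    qed
    have m: "0 \<le> m" by (simp add: m_def)
    have "\<bar>(\<integral>x. f x \<partial>M) - (\<integral>x. f x \<partial>N)\<bar> \<le> e" if e: "0 < e" for e
    proof -
      \<comment> \<open>Two errors of at most \<open>d * m\<close> must add up to at most
        \<open>e\<close>; the summand 1 avoids division by zero for \<open>m = 0\<close>.\<close>
      define d where "d = e / (2 * (m + 1))"
      have "0 < d" using e m by (simp add: d_def)
      then obtain p where "real_polynomial_function p" "\<bar>(\<integral>x. f x \<partial>M) - (\<integral>x. p x \<partial>M)\<bar> \<le> d * m"
        "\<bar>(\<integral>x. f x \<partial>N) - (\<integral>x. p x \<partial>N)\<bar> \<le> d * m"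
        using close by blast
      moreover have "d * m \<le> e / 2" using e m by (simp add: d_def field_simps)
      ultimately show ?thesis using peq[of p] by linarith
    qed
    thus "(\<integral>x. f x \<partial>M) = (\<integral>x. f x \<partial>N)"
      by (metis abs_le_zero_iff dense_ge eq_iff_diff_eq_0)
  qed (use M.sets_M N.sets_M M.finite_measure_axioms N.finite_measure_axioms in auto)
qed

section \<open>Rotation invariance and its effect on the support\<close>

context circle_measure begin

text \<open>The rotation multiplies the moment of order \<open>n\<close> by
  \<open>\<omega> ^ n\<close> and keeps the mass, so uniqueness applies.\<close>

lemma rotate:
  assumes \<omega>: "norm \<omega> = 1"
  shows "distr M borel (\<lambda>z. c + \<omega> * (z - c)) = M"
proof (rule circle_measure_unique[of _ c r])
  have [measurable]: "(\<lambda>z. c + \<omega> * (z - c)) \<in> measurable M borel" by measurable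
  interpret D: finite_measure "distr M borel (\<lambda>z. c + \<omega> * (z - c))"
    by (rule finite_measure_distr) measurable
  show "circle_measure (distr M borel (\<lambda>z. c + \<omega> * (z - c))) c r"
  proof
    show "AE z in distr M borel (\<lambda>z. c + \<omega> * (z - c)). dist c z = r"
      by (subst AE_distr_iff)
        (use AE_circle \<omega> in \<open>auto elim!: eventually_mono simp: dist_norm norm_mult norm_minus_commute\<close>)
    show "(\<integral>z. (z - c) ^ n \<partial>distr M borel (\<lambda>z. c + \<omega> * (z - c))) = 0" if "0 < n" for n
      by (subst integral_distr) (use power_integral[OF that] in \<open>auto simp: power_mult_distrib\<close>)
  qed (use r_pos in auto)
  show "circle_measure M c r" by (rule circle_measure_axioms)
  show "measure (distr M borel (\<lambda>z. c + \<omega> * (z - c))) (space (distr M borel (\<lambda>z. c + \<omega> * (z - c))))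
    = measure M (space M)"
    by (subst measure_distr) auto
qed

text \<open>The rotated copies of \<open>U\<close> are null as well and cover the circle; by
  compactness finitely many of them suffice, so the whole circle is null.\<close>

lemma open_meets_circle_not_null:
  assumes U: "open U" "U \<inter> sphere c r \<noteq> {}" and null: "AE z in M. z \<notin> U"
  shows "measure M (space M) = 0"
proof -
  have UNIV: "space M = UNIV" using sets_eq_imp_space_eq[OF sets_M] by simp
  obtain p where "p \<in> U \<inter> sphere c r" using U by blast
  hence p: "p \<in> U" "dist c p = r" by auto
  \<comment> \<open>\<open>T q\<close> is the preimage of \<open>U\<close> under the rotation about
    \<open>c\<close> that takes \<open>q\<close> to \<open>p\<close>; for \<open>q\<close> on the
    circle it contains \<open>q\<close>.\<close>
  define T where "T q = (\<lambda>z. c + (p - c) / (q - c) * (z - c)) -` U" for q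
  have oT: "open (T q)" for q unfolding T_def
    by (intro open_vimage U continuous_intros)
  have "sphere c r \<subseteq> (\<Union>q\<in>sphere c r. T q)"
  proof
    fix z assume "z \<in> sphere c r"
    moreover from this have "z \<in> T z" using p r_pos by (auto simp: T_def)
    ultimately show "z \<in> (\<Union>q\<in>sphere c r. T q)" by blast
  qed
  then obtain D where D: "D \<subseteq> sphere c r" "finite D" "sphere c r \<subseteq> (\<Union>q\<in>D. T q)"
    using compactE_image[OF compact_sphere, of "sphere c r" T c r] oT by metis
  have "AE z in M. z \<notin> T q" if "q \<in> sphere c r" for q
  proof -
    have "norm ((p - c) / (q - c)) = 1"
      using that p(2) r_pos by (simp add: norm_divide dist_norm norm_minus_commute)
    from rotate[OF this] null 
    have "AE z in distr M borel (\<lambda>z. c + (p - c) / (q - c) * (z - c)). z \<notin> U" by (simp only:)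
    moreover have "{z. z \<notin> U} \<in> sets borel"
    proof -
      have "{z. z \<notin> U} = - U" by auto
      thus ?thesis using U(1) by simp
    qed
    ultimately show ?thesis by (subst (asm) AE_distr_iff) (auto simp: T_def)
  qed
  hence "AE z in M. \<forall>q\<in>D. z \<notin> T q"
    using D by (intro AE_finite_allI) auto
  with AE_circle have "AE z in M. False"
    by eventually_elim (use D(3) in auto)
  thus ?thesis by (simp add: AE_iff_measurable[OF _ refl] measure_def UNIV)
qed

end



section \<open>Arc length on a circle\<close>

lemma dist_circle_points:
  fixes c :: complex and r a b :: real
  assumes "0 \<le> r"
  shows "dist (c + r * cis a) (c + r * cis b) = 2 * r * \<bar>sin ((a - b) / 2)\<bar>"
proof -
  have "(norm (cis a - cis b))\<^sup>2 = (cos a - cos b)\<^sup>2 + (sin a - sin b)\<^sup>2"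
    by (simp add: cmod_power2)
  also have "\<dots> = 2 - 2 * cos (a - b)"
    using sin_cos_squared_add[of a] sin_cos_squared_add[of b]
    by (simp add: cos_diff power2_eq_square algebra_simps)
  also have "cos (a - b) = cos (2 * ((a - b) / 2))" by (simp only: mult_2 field_sum_of_halves)
  also have "\<dots> = 1 - 2 * (sin ((a - b) / 2))\<^sup>2" by (rule cos_double_sin)
  finally have "(norm (cis a - cis b))\<^sup>2 = (2 * \<bar>sin ((a - b) / 2)\<bar>)\<^sup>2"
    by (simp add: power_mult_distrib)
  hence "norm (cis a - cis b) = 2 * \<bar>sin ((a - b) / 2)\<bar>"
    by (rule power2_eq_imp_eq) auto
  thus ?thesis using assms
    by (simp add: dist_norm norm_mult flip: right_diff_distrib)
qed

text \<open>A continuous logarithm of \<open>\<gamma> t - c\<close> provides a continuous angle.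
  Equal angles give equal points, so simplicity of the loop makes the angle injective, hence
  strictly monotone on the interval.\<close>

lemma circle_loop_angle:
  assumes \<gamma>: "simple_path \<gamma>" "pathfinish \<gamma> = pathstart \<gamma>" "path_image \<gamma> \<subseteq> sphere c r" and r: "0 < r"
  obtains \<phi> :: "real \<Rightarrow> real" and s where "continuous_on {0..1} \<phi>" "strict_mono_on {0..1} \<phi>"
    "\<bar>s\<bar> = 1" "\<And>t. t \<in> {0..1} \<Longrightarrow> \<gamma> t = c + r * cis (s * \<phi> t)"
proof -
  have S: "dist c (\<gamma> t) = r" if "t \<in> {0..1}" for t
    using that \<gamma>(3) unfolding path_image_def by (metis imageI mem_sphere subsetD)
  have cont: "continuous_on {0..1} (\<lambda>t. \<gamma> t - c)"
    using \<gamma>(1) by (auto simp: simple_path_def path_def intro!: continuous_intros)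
  have ne: "\<gamma> t - c \<noteq> 0" if "t \<in> {0..1}" for t
    using S[OF that] r by auto
  have con: "contractible {0..1::real}"
    by (intro convex_imp_contractible) auto
  obtain g where g: "continuous_on {0..1} g" "\<And>t. t \<in> {0..1} \<Longrightarrow> \<gamma> t - c = exp (g t)"
    using continuous_logarithm_on_contractible[OF cont con ne] by blast
  define \<theta> where "\<theta> t = Im (g t)" for t
  have \<theta>c: "continuous_on {0..1} \<theta>"
    unfolding \<theta>_def by (intro continuous_intros g)
  have \<gamma>\<theta>: "\<gamma> t = c + r * cis (\<theta> t)" if "t \<in> {0..1}" for t
  proof -
    have "norm (\<gamma> t - c) = r" using S[OF that] by (simp add: dist_norm norm_minus_commute)
    hence "exp (Re (g t)) = r" using g(2)[OF that] by simp
    hence "exp (g t) = r * cis (\<theta> t)"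
      unfolding \<theta>_def by (simp add: exp_eq_polar)
    thus ?thesis using g(2)[OF that] by (simp add: algebra_simps)
  qed
  have inj: "x = y \<or> x = 0 \<and> y = 1 \<or> x = 1 \<and> y = 0" if "x \<in> {0..1}" "y \<in> {0..1}" "\<theta> x = \<theta> y" for x y
    using that \<gamma>\<theta>[OF that(1)] \<gamma>\<theta>[OF that(2)] \<gamma>(1) unfolding simple_path_def loop_free_def by metis
  \<comment> \<open>With equal end values, the midpoint \<open>v\<close> between
    \<open>\<theta> 0\<close> and \<open>\<theta> (1/2)\<close> would be attained on both halves of
    the interval. As \<open>v\<close> differs from both of these values, the two parameters are
    distinct and not the pair of end points.\<close>
  have "\<theta> 0 \<noteq> \<theta> 1"
  proof
    assume e: "\<theta> 0 = \<theta> 1"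
    define v where "v = (\<theta> 0 + \<theta> (1/2)) / 2"
    have ne: "\<theta> 0 \<noteq> \<theta> (1/2)" using inj[of 0 "1/2"] by auto
    have c1: "continuous_on {0..1/2} \<theta>" "continuous_on {1/2..1} \<theta>"
      using \<theta>c by (auto elim: continuous_on_subset)
    have "\<exists>x\<ge>0. x \<le> 1/2 \<and> \<theta> x = v"
      using IVT'[OF _ _ _ c1(1), of v] IVT2'[OF _ _ _ c1(1), of v]
      by (cases "\<theta> 0 \<le> \<theta> (1/2)") (auto simp: v_def)
    moreover have "\<exists>x\<ge>1/2. x \<le> 1 \<and> \<theta> x = v"
      using IVT'[OF _ _ _ c1(2), of v] IVT2'[OF _ _ _ c1(2), of v] e
      by (cases "\<theta> 0 \<le> \<theta> (1/2)") (auto simp: v_def)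
    ultimately obtain x y where xy: "0 \<le> x" "x \<le> 1/2" "1/2 \<le> y" "y \<le> 1" "\<theta> x = v" "\<theta> y = v" by blast
    have v: "v \<noteq> \<theta> 0" "v \<noteq> \<theta> (1/2)" using ne by (auto simp: v_def field_simps)
    have "x \<noteq> 1/2" using xy(5) v(2) by blast
    hence "x < y" using xy by linarith
    thus False using inj[of x y] xy e v(1) by auto
  qed
  have inj': "inj_on \<theta> {0..1}"
  proof (rule inj_onI)
    fix x y assume "x \<in> {0..1}" "y \<in> {0..1}" "\<theta> x = \<theta> y"
    thus "x = y" using inj[of x y] \<open>\<theta> 0 \<noteq> \<theta> 1\<close> by auto
  qed
  \<comment> \<open>\<open>s\<close> is the orientation of the loop; multiplying by it makes the
    angle increasing.\<close>
  define s :: real where "s = (if \<theta> 0 < \<theta> 1 then 1 else -1)"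
  define \<phi> where "\<phi> t = s * \<theta> t" for t
  have s: "s * s = 1" "\<bar>s\<bar> = 1" by (auto simp: s_def)
  have \<phi>c: "continuous_on {0..1} \<phi>" unfolding \<phi>_def by (intro continuous_intros \<theta>c)
  have \<phi>i: "inj_on \<phi> {0..1}" using inj' s by (auto simp: inj_on_def \<phi>_def)
  have 01: "\<phi> 0 < \<phi> 1" using \<open>\<theta> 0 \<noteq> \<theta> 1\<close> by (auto simp: \<phi>_def s_def)
  have mid: "\<phi> 0 < \<phi> x \<and> \<phi> x < \<phi> 1" if "0 < x" "x < 1" for x
    using continuous_inj_imp_mono[OF that \<phi>c \<phi>i] 01 by auto
  have "\<phi> x < \<phi> y" if xy: "x \<in> {0..1}" "y \<in> {0..1}" "x < y" for x y
  proof (cases "x = 0")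
    case True
    thus ?thesis using xy mid[of y] 01 by (cases "y = 1") auto
  next
    case False
    have "continuous_on {0..y} \<phi>" "inj_on \<phi> {0..y}"
      using \<phi>c \<phi>i xy by (auto elim!: continuous_on_subset inj_on_subset)
    from continuous_inj_imp_mono[OF _ _ this, of x] False xy mid[of y] 01
    show ?thesis by (cases "y = 1") auto
  qed
  hence \<phi>m: "strict_mono_on {0..1} \<phi>" by (auto simp: strict_mono_on_def)
  have "s * \<phi> t = \<theta> t" for t using s(1) by (simp add: \<phi>_def flip: mult.assoc)
  with that[OF \<phi>c \<phi>m s(2)] \<gamma>\<theta> show ?thesis by simp
qed

text \<open>Chords are at most as long as their arcs, and the arcs telescope; this bounds the length
  above. From below, \<open>N\<close> equal angular steps give the chord sum
  \<open>2 * r * N * sin (\<Delta> / (2 * N))\<close>, which tends to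
  \<open>r * \<Delta>\<close>.\<close>

lemma length_between_circle:
  fixes \<phi> :: "real \<Rightarrow> real"
  assumes r: "0 < r" and \<phi>: "continuous_on {0..1} \<phi>" "strict_mono_on {0..1} \<phi>" and s: "\<bar>s\<bar> = 1"
    and \<gamma>: "\<And>t. t \<in> {0..1} \<Longrightarrow> \<gamma> t = c + r * cis (s * \<phi> t)" and t: "t \<in> {0..1}"
  shows "length_between \<gamma> 0 t = ennreal (r * (\<phi> t - \<phi> 0))"
proof (rule antisym)
  have mono: "\<phi> x \<le> \<phi> y" if "0 \<le> x" "x \<le> y" "y \<le> 1" for x y
    using strict_mono_on_leD[OF \<phi>(2), of x y] that by auto
  have d: "dist (\<gamma> x) (\<gamma> y) = 2 * r * \<bar>sin ((\<phi> y - \<phi> x) / 2)\<bar>" if "x \<in> {0..1}" "y \<in> {0..1}" for x y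
  proof -
    have "dist (\<gamma> x) (\<gamma> y) = 2 * r * \<bar>sin ((s * \<phi> x - s * \<phi> y) / 2)\<bar>"
      unfolding \<gamma>[OF that(1)] \<gamma>[OF that(2)] by (rule dist_circle_points) (use r in simp)
    also have "(s * \<phi> x - s * \<phi> y) / 2 = - s * ((\<phi> y - \<phi> x) / 2)" by (simp add: algebra_simps)
    also have "\<bar>sin (- s * v)\<bar> = \<bar>sin v\<bar>" for v
      using s by (cases "s = 1") (auto simp: abs_if split: if_splits)
    finally show ?thesis .
  qed
  show "length_between \<gamma> 0 t \<le> ennreal (r * (\<phi> t - \<phi> 0))"
    unfolding length_between_def
  proof (rule SUP_least, clarify)
    fix ts :: "real list"
    assume ts: "sorted ts" "set ts \<subseteq> {0..t}"
    have mem: "ts ! i \<in> {0..t}" if "i < length ts" for i using ts(2) that nth_mem by blast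
    have "(\<Sum>i<length ts - 1. dist (\<gamma> (ts ! i)) (\<gamma> (ts ! Suc i)))
      \<le> (\<Sum>i<length ts - 1. r * \<phi> (ts ! Suc i) - r * \<phi> (ts ! i))"
    proof (rule sum_mono)
      fix i assume "i \<in> {..<length ts - 1}"
      hence i: "i < length ts" "Suc i < length ts" by auto
      have le: "ts ! i \<le> ts ! Suc i" using ts(1) i by (simp add: sorted_iff_nth_mono)
      have "\<bar>sin ((\<phi> (ts ! Suc i) - \<phi> (ts ! i)) / 2)\<bar> \<le> (\<phi> (ts ! Suc i) - \<phi> (ts ! i)) / 2"
        using abs_sin_x_le_abs_x[of "(\<phi> (ts ! Suc i) - \<phi> (ts ! i)) / 2"] mono[OF _ le] mem[OF i(1)] mem[OF i(2)] t
        by auto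
      hence "2 * r * \<bar>sin ((\<phi> (ts ! Suc i) - \<phi> (ts ! i)) / 2)\<bar> \<le> 2 * r * ((\<phi> (ts ! Suc i) - \<phi> (ts ! i)) / 2)"
        using r by (intro mult_left_mono) auto
      thus "dist (\<gamma> (ts ! i)) (\<gamma> (ts ! Suc i)) \<le> r * \<phi> (ts ! Suc i) - r * \<phi> (ts ! i)"
        using d[of "ts ! i" "ts ! Suc i"] mem[OF i(1)] mem[OF i(2)] t by (simp add: algebra_simps)
    qed
    also have "\<dots> = r * \<phi> (ts ! (length ts - 1)) - r * \<phi> (ts ! 0)"
      by (rule sum_lessThan_telescope)
    also have "\<dots> \<le> r * (\<phi> t - \<phi> 0)"
    \<comment> \<open>For the empty list truncated subtraction makes both indices 0, so the
      telescoped difference is 0 whatever \<open>ts ! 0\<close> denotes.\<close>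
    proof (cases "ts = []")
      case False
      hence "\<phi> (ts ! (length ts - 1)) \<le> \<phi> t" "\<phi> 0 \<le> \<phi> (ts ! 0)"
        using mem[of 0] mem[of "length ts - 1"] t by (auto intro!: mono)
      hence "r * \<phi> (ts ! (length ts - 1)) \<le> r * \<phi> t" "r * \<phi> 0 \<le> r * \<phi> (ts ! 0)"
        using r by simp_all
      thus ?thesis by (simp add: right_diff_distrib)
    next
      case True
      thus ?thesis using r mono[of 0 t] t by simp
    qed
    finally show "(\<Sum>i<length ts - 1. ennreal (dist (\<gamma> (ts ! i)) (\<gamma> (ts ! Suc i)))) \<le> ennreal (r * (\<phi> t - \<phi> 0))"
      by (subst sum_ennreal) (auto intro: ennreal_leI)
  qed
  define \<Delta> where "\<Delta> = \<phi> t - \<phi> 0"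
  have \<Delta>0: "0 \<le> \<Delta>" using mono[of 0 t] t by (simp add: \<Delta>_def)
  have part: "ennreal (real N * (2 * r * \<bar>sin (\<Delta> / (2 * real N))\<bar>)) \<le> length_between \<gamma> 0 t" if N: "0 < N" for N :: nat
  proof -
    \<comment> \<open>The intermediate value theorem yields parameters at which the angle is equally
      spaced.\<close>
    have "\<exists>x\<ge>0. x \<le> t \<and> \<phi> x = \<phi> 0 + real i * \<Delta> / N" if "i \<le> N" for i
    proof (rule IVT')
      have "real i * \<Delta> \<le> real N * \<Delta>" using that \<Delta>0 by (intro mult_right_mono) auto
      hence "real i * \<Delta> / N \<le> \<Delta>" using N by (simp add: field_simps)
      thus "\<phi> 0 + real i * \<Delta> / N \<le> \<phi> t" by (simp add: \<Delta>_def)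
      show "continuous_on {0..t} \<phi>" using \<phi>(1) t by (auto elim!: continuous_on_subset)
    qed (use t \<Delta>0 in auto)
    then obtain x where x: "\<And>i. i \<le> N \<Longrightarrow> 0 \<le> x i \<and> x i \<le> t \<and> \<phi> (x i) = \<phi> 0 + real i * \<Delta> / N"
      by metis
    have x_le: "x i \<le> x j" if "i \<le> j" "j \<le> N" for i j
    proof (rule ccontr)
      assume "\<not> x i \<le> x j"
      hence "\<phi> (x j) < \<phi> (x i)"
        using x[of i] x[of j] that t by (intro strict_mono_onD[OF \<phi>(2)]) auto
      hence "real j * \<Delta> / N < real i * \<Delta> / N" using x[of i] x[of j] that by simp
      moreover have "real i * \<Delta> / N \<le> real j * \<Delta> / N"
        using that \<Delta>0 by (intro divide_right_mono mult_right_mono) auto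
      ultimately show False by simp
    qed
    define ts where "ts = map x [0..<Suc N]"
    have nth: "ts ! i = x i" if "i \<le> N" for i using that unfolding ts_def by (simp del: upt_Suc)
    have len: "length ts = Suc N" by (simp add: ts_def)
    have "ts \<in> {ts. sorted ts \<and> set ts \<subseteq> {0..t}}"
      using x x_le nth len by (auto simp: sorted_iff_nth_mono in_set_conv_nth)
    hence "(\<Sum>i<length ts - 1. ennreal (dist (\<gamma> (ts ! i)) (\<gamma> (ts ! Suc i)))) \<le> length_between \<gamma> 0 t"
      unfolding length_between_def by (rule SUP_upper)
    also have "(\<Sum>i<length ts - 1. ennreal (dist (\<gamma> (ts ! i)) (\<gamma> (ts ! Suc i))))
      = (\<Sum>i<N. ennreal (2 * r * \<bar>sin (\<Delta> / (2 * real N))\<bar>))"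
    proof (rule sum.cong)
      fix i assume "i \<in> {..<N}"
      hence i: "i \<le> N" "Suc i \<le> N" by auto
      have "\<phi> (x (Suc i)) - \<phi> (x i) = \<Delta> / N"
        using x[OF i(1)] x[OF i(2)] by (simp add: add_divide_distrib algebra_simps)
      moreover have "x i \<in> {0..1}" "x (Suc i) \<in> {0..1}" using x[OF i(1)] x[OF i(2)] t by auto
      ultimately show "ennreal (dist (\<gamma> (ts ! i)) (\<gamma> (ts ! Suc i))) = ennreal (2 * r * \<bar>sin (\<Delta> / (2 * real N))\<bar>)"
        using d[of "x i" "x (Suc i)"] by (simp add: nth[OF i(1)] nth[OF i(2)] mult.commute)
    qed (simp add: len)
    also have "\<dots> = ennreal (\<Sum>i<N. 2 * r * \<bar>sin (\<Delta> / (2 * real N))\<bar>)"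
      using r by (intro sum_ennreal) auto
    finally show ?thesis by simp
  qed
  show "ennreal (r * (\<phi> t - \<phi> 0)) \<le> length_between \<gamma> 0 t"
  proof (cases "\<Delta> = 0")
    case False
    hence "\<Delta> > 0" using \<Delta>0 by simp
    hence "(\<lambda>N. real N * (2 * r * \<bar>sin (\<Delta> / (2 * real N))\<bar>)) \<longlonglongrightarrow> r * \<Delta>"
      using r by real_asymp
    hence "(\<lambda>N. ennreal (real N * (2 * r * \<bar>sin (\<Delta> / (2 * real N))\<bar>))) \<longlonglongrightarrow> ennreal (r * \<Delta>)"
      by (rule tendsto_ennrealI)
    thus ?thesis
      unfolding \<Delta>_def[symmetric] by (rule LIMSEQ_le_const2) (use part in \<open>auto intro!: exI[of _ 1]\<close>)
  qed (simp add: \<Delta>_def)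
qed

lemma length_fun_circle:
  fixes \<phi> :: "real \<Rightarrow> real"
  assumes r: "0 < r" and \<phi>: "continuous_on {0..1} \<phi>" "strict_mono_on {0..1} \<phi>" and s: "\<bar>s\<bar> = 1"
    and \<gamma>: "\<And>t. t \<in> {0..1} \<Longrightarrow> \<gamma> t = c + r * cis (s * \<phi> t)"
  shows "length_fun \<gamma> = (\<lambda>t. r * (\<phi> (max 0 (min t 1)) - \<phi> 0))"
proof
  fix t :: real
  show "length_fun \<gamma> t = r * (\<phi> (max 0 (min t 1)) - \<phi> 0)"
  proof (cases "t < 0")
    case True
    hence "{ts. sorted ts \<and> set ts \<subseteq> {0..min t 1}} = {[]}" by auto
    thus ?thesis using True by (simp add: length_fun_def length_between_def)
  next
    case False
    hence m: "min t 1 \<in> {0..1}" "max 0 (min t 1) = min t 1" by auto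
    have "\<phi> 0 \<le> \<phi> (min t 1)" using strict_mono_on_leD[OF \<phi>(2), of 0 "min t 1"] m by auto
    thus ?thesis unfolding length_fun_def m(2)
      using length_between_circle[OF r \<phi> s \<gamma> m(1)] r by simp
  qed
qed

text \<open>This is reparametrisation by arc length: \<open>L\<close> maps its own Stieltjes measure
  to Lebesgue measure, since \<open>{t. x < L t}\<close> is an interval from the preimage of
  \<open>x\<close> to 1, of mass \<open>L 1 - x\<close>. The rays above \<open>x\<close> determine a
  measure.\<close>

lemma distr_interval_measure_self:
  fixes L :: "real \<Rightarrow> real"
  assumes L: "mono L" "continuous_on UNIV L" "strict_mono_on {0..1} L" "L 0 = 0"
  shows "distr (restrict_space (interval_measure L) {0..1}) borel L = density lborel (indicator {0..L 1})"
    (is "?P = ?Q")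
proof (rule measure_eqI_lessThan)
  have [measurable]: "L \<in> borel_measurable borel" by (rule borel_measurable_continuous_onI[OF L(2)])
  have Lm: "L \<in> measurable (restrict_space (interval_measure L) {0..1}) borel"
    by (intro measurable_restrict_space1) measurable
  have mono: "L x \<le> L y" if "x \<le> y" for x y using L(1) that by (rule monoD)
  have rc: "continuous (at_right a) L" for a
    using L(2) by (simp add: continuous_on_eq_continuous_at continuous_at_imp_continuous_within)
  have P: "emeasure ?P {x<..} = emeasure (interval_measure L) {t\<in>{0..1}. x < L t}" for x
  proof -
    have "emeasure ?P {x<..} = emeasure (restrict_space (interval_measure L) {0..1}) (L -` {x<..} \<inter> {0..1})"
      by (subst emeasure_distr[OF Lm]) (auto simp: space_restrict_space)
    also have "L -` {x<..} \<inter> {0..1} = {t\<in>{0..1}. x < L t}" by auto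
    finally show ?thesis by (subst (asm) emeasure_restrict_space) auto
  qed
  have Q: "emeasure ?Q {x<..} = emeasure lborel ({0..L 1} \<inter> {x<..})" for x
    by (simp add: emeasure_density flip: indicator_inter_arith)
  have L1: "0 \<le> L 1" using mono[of 0 1] L(4) by simp
  have fin: "emeasure (interval_measure L) {0..1} = L 1"
    using emeasure_interval_measure_Icc[OF _ mono L(2), of 0 1] L(4) by simp
  show "emeasure ?P {x<..} < \<infinity>" for x
  proof -
    have "emeasure ?P {x<..} \<le> emeasure (interval_measure L) {0..1}"
      unfolding P by (rule emeasure_mono) auto
    thus ?thesis unfolding fin by (simp add: le_less_trans)
  qed
  show "emeasure ?P {x<..} = emeasure ?Q {x<..}" for x
  proof -
    consider "x < 0" | "0 \<le> x" "x < L 1" | "L 1 \<le> x" by linarith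
    thus ?thesis
    proof cases
      case 1
      have A: "{t\<in>{0..1}. x < L t} = {0..1}" using mono[of 0] L(4) 1 by force
      have B: "{0..L 1} \<inter> {x<..} = {0..L 1}" using 1 by auto
      show ?thesis unfolding P Q A B using L1 fin by simp
    next
      case 3
      have A: "{t\<in>{0..1}. x < L t} = {}" using mono[of _ 1] 3 by force
      have B: "{0..L 1} \<inter> {x<..} = {}" using 3 by auto
      show ?thesis unfolding P Q A B by simp
    next
      case 2
      obtain u where u: "0 \<le> u" "u \<le> 1" "L u = x"
        using IVT'[of L 0 x 1] 2 L(4) continuous_on_subset[OF L(2)] by auto
      have A: "{t\<in>{0..1}. x < L t} = {u<..1}"
        using u strict_mono_on_less[OF L(3), of u] by force
      have B: "{0..L 1} \<inter> {x<..} = {x<..L 1}" using 2 by auto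
      show ?thesis unfolding P Q A B
        using emeasure_interval_measure_Ioc[OF u(2) mono rc] 2 u(3) by simp
    qed
  qed
qed auto


text \<open>Arc length before completion. Image measures and densities are computed on these Borel
  traces and transferred to the completion only at the end.\<close>

definition arc_length_premeasure :: "(real \<Rightarrow> complex) set \<Rightarrow> complex measure" where
  "arc_length_premeasure \<Gamma> =
     measure_of (curve_image \<Gamma>) (sets (restrict_space borel (curve_image \<Gamma>)))
       (\<lambda>A. \<Sum>\<gamma>\<in>\<Gamma>. emeasure (interval_measure (length_fun \<gamma>)) {t\<in>{0..1}. \<gamma> t \<in> A})"

lemma arc_length_measure_eq_completion: "arc_length_measure \<Gamma> = completion (arc_length_premeasure \<Gamma>)"
  by (simp add: arc_length_measure_def arc_length_premeasure_def)

lemma sets_arc_length_premeasure [measurable_cong]: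
  "sets (arc_length_premeasure \<Gamma>) = sets (restrict_space borel (curve_image \<Gamma>))"
proof -
  have "sigma_algebra (curve_image \<Gamma>) (sets (restrict_space borel (curve_image \<Gamma>)))"
    using sets.sigma_algebra_axioms[of "restrict_space borel (curve_image \<Gamma>)"]
    by (simp add: space_restrict_space)
  thus ?thesis unfolding arc_length_premeasure_def by (rule sigma_algebra.sets_measure_of_eq)
qed

lemma space_arc_length_premeasure: "space (arc_length_premeasure \<Gamma>) = curve_image \<Gamma>"
  using sets_eq_imp_space_eq[OF sets_arc_length_premeasure] by (simp add: space_restrict_space)

lemma id_measurable_arc_length_premeasure: "(\<lambda>z. z) \<in> measurable (arc_length_premeasure \<Gamma>) borel"
  by (subst measurable_cong_sets[OF sets_arc_length_premeasure refl])
    (intro measurable_restrict_space1 measurable_ident_sets refl)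

lemma measurable_path:
  assumes "path \<gamma>"
  shows "\<gamma> \<in> measurable (restrict_space (interval_measure F) {0..1}) (restrict_space borel (path_image \<gamma>))"
proof -
  have "\<gamma> \<in> borel_measurable (restrict_space borel {0..1})"
    using assms unfolding path_def by (rule borel_measurable_continuous_on_restrict)
  thus ?thesis
    by (intro measurable_restrict_space2)
      (auto simp: path_image_def space_restrict_space cong: measurable_cong_sets sets_restrict_space_cong)
qed

text \<open>\<open>measure_of\<close> returns the prescribed set function only if that is a measure.
  For a single loop it agrees with an image measure, which ensures this.\<close>

lemma arc_length_premeasure_single:
  assumes "path \<gamma>"
  shows "arc_length_premeasure {\<gamma>} =
    distr (restrict_space (interval_measure (length_fun \<gamma>)) {0..1}) (restrict_space borel (path_image \<gamma>)) \<gamma>"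
    (is "_ = ?D")
proof -
  have ci: "curve_image {\<gamma>} = path_image \<gamma>" by (simp add: curve_image_def)
  note m = measurable_path[OF assms, of "length_fun \<gamma>"]
  have sp: "space ?D = path_image \<gamma>" "sets ?D = sets (restrict_space borel (path_image \<gamma>))"
    by (simp_all add: space_restrict_space)
  have "arc_length_premeasure {\<gamma>} = measure_of (space ?D) (sets ?D) (emeasure ?D)"
    unfolding arc_length_premeasure_def ci sp
  proof (rule measure_of_eq)
    show "sets (restrict_space borel (path_image \<gamma>)) \<subseteq> Pow (path_image \<gamma>)"
      using sets.sets_into_space[of _ "restrict_space borel (path_image \<gamma>)"]
      by (auto simp: space_restrict_space)
    fix A assume "A \<in> sigma_sets (path_image \<gamma>) (sets (restrict_space borel (path_image \<gamma>)))"
    hence A: "A \<in> sets (restrict_space borel (path_image \<gamma>))"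
      using sets.sigma_sets_eq[of "restrict_space borel (path_image \<gamma>)"]
      by (simp add: space_restrict_space)
    have "emeasure ?D A = emeasure (restrict_space (interval_measure (length_fun \<gamma>)) {0..1}) (\<gamma> -` A \<inter> {0..1})"
      by (subst emeasure_distr[OF m A]) (simp add: space_restrict_space)
    also have "\<dots> = emeasure (interval_measure (length_fun \<gamma>)) (\<gamma> -` A \<inter> {0..1})"
      by (rule emeasure_restrict_space) auto
    also have "\<gamma> -` A \<inter> {0..1} = {t\<in>{0..1}. \<gamma> t \<in> A}" by auto
    finally show "(\<Sum>\<gamma>\<in>{\<gamma>}. emeasure (interval_measure (length_fun \<gamma>)) {t\<in>{0..1}. \<gamma> t \<in> A}) = emeasure ?D A"
      by simp
  qed
  also have "\<dots> = ?D" by (rule measure_of_of_measure)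
  finally show ?thesis .
qed

text \<open>Parametrised by arc length, the moments become integrals of exponentials over an
  interval. The antiderivative is again an exponential, with equal end values because the loop
  closes.\<close>

lemma circle_measure_arc_length:
  assumes \<gamma>: "simple_path \<gamma>" "pathfinish \<gamma> = pathstart \<gamma>" "path_image \<gamma> = sphere c r" and r: "0 < r"
  shows "circle_measure (distr (arc_length_premeasure {\<gamma>}) borel (\<lambda>z. z)) c r"
proof -
  obtain \<phi> s where \<phi>: "continuous_on {0..1} \<phi>" "strict_mono_on {0..1} \<phi>" and s: "\<bar>s\<bar> = 1"
    and \<gamma>\<phi>: "\<And>t. t \<in> {0..1} \<Longrightarrow> \<gamma> t = c + r * cis (s * \<phi> t)"
    using circle_loop_angle[OF \<gamma>(1,2) _ r] \<gamma>(3) by (metis order_refl)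
  define L where "L = length_fun \<gamma>"
  have L: "L = (\<lambda>t. r * (\<phi> (max 0 (min t 1)) - \<phi> 0))"
    unfolding L_def by (rule length_fun_circle[OF r \<phi> s \<gamma>\<phi>])
  have L01: "L t = r * (\<phi> t - \<phi> 0)" if "t \<in> {0..1}" for t using that by (simp add: L)
  have Lmono: "mono L"
  proof (rule monoI)
    fix x y :: real assume "x \<le> y"
    hence "\<phi> (max 0 (min x 1)) \<le> \<phi> (max 0 (min y 1))"
      by (intro strict_mono_on_leD[OF \<phi>(2)]) auto
    thus "L x \<le> L y" unfolding L using r by simp
  qed
  have Lcont: "continuous_on UNIV L" unfolding L
    by (intro continuous_intros continuous_on_compose2[OF \<phi>(1)]) auto
  have Lstrict: "strict_mono_on {0..1} L"
    using strict_mono_onD[OF \<phi>(2)] r by (auto simp: strict_mono_on_def L01)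
  define I where "I = restrict_space (interval_measure L) {0..1}"
  define U where "U = density lborel (indicator {0..L 1} :: real \<Rightarrow> ennreal)"
  \<comment> \<open>\<open>h\<close> takes complex arguments so that complex differentiation
    applies; \<open>E\<close> is the parametrisation of the loop by arc length.\<close>
  define h where "h z = r * exp (\<i> * s * (z / r + \<phi> 0))" for z :: complex
  define E where "E x = c + h (of_real x)" for x :: real
  have hcis: "h (of_real x) = r * cis (s * (x / r + \<phi> 0))" for x
    by (simp add: h_def cis_conv_exp algebra_simps)
  have Econt: "continuous_on UNIV E" unfolding E_def h_def by (intro continuous_intros) (use r in auto)
  have [measurable]: "E \<in> borel_measurable borel" by (rule borel_measurable_continuous_onI[OF Econt])
  have [measurable]: "L \<in> borel_measurable I"
    unfolding I_def using borel_measurable_continuous_onI[OF Lcont]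
    by (intro measurable_restrict_space1) (simp cong: measurable_cong_sets)
  have EL: "\<gamma> t = E (L t)" if "t \<in> {0..1}" for t
  proof -
    have "L t / r + \<phi> 0 = \<phi> t" using r by (simp add: L01[OF that])
    thus ?thesis by (simp only: E_def hcis \<gamma>\<phi>[OF that])
  qed
  have p: "path \<gamma>" using \<gamma>(1) by (rule simple_path_imp_path)
  have m: "\<gamma> \<in> measurable I (restrict_space borel (path_image \<gamma>))"
    unfolding I_def by (rule measurable_path[OF p])
  have "distr (arc_length_premeasure {\<gamma>}) borel (\<lambda>z. z) = distr I borel \<gamma>"
    unfolding arc_length_premeasure_single[OF p] L_def[symmetric] I_def[symmetric]
    by (subst distr_distr[OF _ m]) (auto simp: comp_def intro!: measurable_restrict_space1)
  also have "\<dots> = distr I borel (E \<circ> L)"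
    by (rule distr_cong) (auto simp: I_def space_restrict_space EL)
  also have "\<dots> = distr (distr I borel L) borel E"
    by (rule distr_distr[symmetric]) auto
  also have "distr I borel L = U"
    unfolding I_def U_def by (rule distr_interval_measure_self[OF Lmono Lcont Lstrict]) (simp add: L)
  finally have N: "distr (arc_length_premeasure {\<gamma>}) borel (\<lambda>z. z) = distr U borel E" .
  have L1: "0 \<le> L 1" using monoD[OF Lmono, of 0 1] by (simp add: L)
  have sU [measurable_cong]: "sets U = sets borel" by (simp add: U_def)
  interpret U: finite_measure U
    by standard (simp add: U_def emeasure_density L1)
  interpret N: finite_measure "distr U borel E"
    by (rule U.finite_measure_distr) measurable
  show ?thesis unfolding N
  proof
    have "dist c (E x) = r" for x using r by (simp add: E_def hcis dist_norm norm_mult)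
    thus "AE z in distr U borel E. dist c z = r"
      by (subst AE_distr_iff) auto
    fix n :: nat assume n: "0 < n"
    \<comment> \<open>The derivative of \<open>h\<close> is \<open>h * (\<i> * s / r)\<close>, so
      with this constant \<open>h ^ n * k\<close> is an antiderivative of
      \<open>h ^ n\<close>.\<close>
    define k where "k = r / (\<i> * s * n)"
    have s0: "s \<noteq> 0" using s by auto
    have "(\<integral>z. (z - c) ^ n \<partial>distr U borel E) = (\<integral>x. h (of_real x) ^ n \<partial>U)"
      by (subst integral_distr) (auto simp: E_def)
    also have "\<dots> = (\<integral>x. h (of_real x) ^ n \<partial>density lborel (\<lambda>x. ennreal (indicator {0..L 1} x)))"
      by (simp add: U_def ennreal_indicator)
    also have "\<dots> = (\<integral>x. indicator {0..L 1} x *\<^sub>R h (of_real x) ^ n \<partial>lborel)"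
      by (subst integral_density) (auto simp: h_def)
    also have "\<dots> = h (of_real (L 1)) ^ n * k - h (of_real 0) ^ n * k"
    proof (rule integral_FTC_atLeastAtMost[OF L1])
      fix x :: real
      have "((\<lambda>z. h z ^ n * k) has_field_derivative h (of_real x) ^ n) (at (of_real x))"
      proof -
        have "(h has_field_derivative h z * (\<i> * s / r)) (at z)" for z
          unfolding h_def by (auto intro!: derivative_eq_intros simp: r)
        hence "((\<lambda>z. h z ^ n * k) has_field_derivative
            of_nat n * (h z * (\<i> * s / r)) * h z ^ (n - 1) * k) (at z)" for z
          by (auto intro!: derivative_eq_intros)
        moreover have "of_nat n * (h z * (\<i> * s / r)) * h z ^ (n - 1) * k = h z ^ n" for z
        proof -
          have *: "N * (H * (\<i> * S / R)) * P * (R / (\<i> * S * N)) = H * P"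
            if "N \<noteq> 0" "S \<noteq> 0" "R \<noteq> 0" for N S R H P :: complex
            using that by (simp add: field_simps)
          have "h z * h z ^ (n - 1) = h z ^ n" using n by (simp add: power_eq_if)
          thus ?thesis unfolding k_def using *[of "of_nat n" "of_real s" "of_real r"] n s0 r by simp
        qed
        ultimately show ?thesis by metis
      qed
      thus "((\<lambda>x. h (of_real x) ^ n * k) has_vector_derivative h (of_real x) ^ n) (at x within {0..L 1})"
        by (rule has_vector_derivative_real_field)
    next
      show "continuous_on {0..L 1} (\<lambda>x. h (of_real x) ^ n)"
        unfolding h_def by (intro continuous_intros) (use r in auto)
    qed
    also have "h (of_real (L 1)) = h (of_real 0)"
      using EL[of 0] EL[of 1] \<gamma>(2) by (simp add: E_def L01[of 0] pathstart_def pathfinish_def)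
    finally show "(\<integral>z. (z - c) ^ n \<partial>distr U borel E) = 0" by simp
  qed (use r in auto)
qed



section \<open>Planar topology\<close>

text \<open>Otherwise one image and the union of the others would be disjoint nonempty closed sets
  separating the curve.\<close>

lemma disjoint_paths_connected_single:
  assumes "finite \<Gamma>" "\<And>\<gamma>. \<gamma> \<in> \<Gamma> \<Longrightarrow> path \<gamma>" "disjoint_family_on path_image \<Gamma>"
    and "connected (curve_image \<Gamma>)" "curve_image \<Gamma> \<noteq> {}"
  obtains \<gamma> where "\<Gamma> = {\<gamma>}"
proof -
  obtain \<gamma> where \<gamma>: "\<gamma> \<in> \<Gamma>" using assms(5) by (auto simp: curve_image_def)
  have "\<Gamma> = {\<gamma>}"
  proof (rule ccontr)
    assume "\<Gamma> \<noteq> {\<gamma>}"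
    then obtain \<gamma>' where \<gamma>': "\<gamma>' \<in> \<Gamma>" "\<gamma>' \<noteq> \<gamma>" using \<gamma> by blast
    let ?B = "\<Union>\<eta>\<in>\<Gamma> - {\<gamma>}. path_image \<eta>"
    have "closed (path_image \<gamma>)" "closed ?B"
      using assms(1,2) \<gamma> by (auto intro!: closed_UN closed_path_image)
    moreover have "path_image \<gamma> \<inter> ?B = {}"
      using assms(3) \<gamma> unfolding disjoint_family_on_def by blast
    moreover have "curve_image \<Gamma> \<subseteq> path_image \<gamma> \<union> ?B"
      by (auto simp: curve_image_def)
    ultimately have "path_image \<gamma> \<inter> curve_image \<Gamma> = {} \<or> ?B \<inter> curve_image \<Gamma> = {}"
      using connected_closedD[OF assms(4)] by blast
    moreover have "path_image \<gamma> \<subseteq> curve_image \<Gamma>" "path_image \<gamma>' \<subseteq> ?B \<inter> curve_image \<Gamma>"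
      using \<gamma> \<gamma>' by (auto simp: curve_image_def)
    ultimately show False using path_image_nonempty by blast
  qed
  thus ?thesis by (rule that)
qed

text \<open>Both complementary components miss the circle, so each lies in the open disc or off the
  closed disc. The unbounded one lies off it, and its frontier is the whole curve, which thus misses
  the open disc. Then \<open>c\<close> belongs to the bounded component; this one lies in the disc,
  and its frontier is again the curve.\<close>

lemma Jordan_curve_superset_circle:
  fixes c :: complex
  assumes \<gamma>: "simple_path \<gamma>" "pathfinish \<gamma> = pathstart \<gamma>" and S: "sphere c r \<subseteq> path_image \<gamma>" and r: "0 < r"
  shows "path_image \<gamma> = sphere c r"
proof -
  let ?J = "path_image \<gamma>"
  note J = Jordan_inside_outside[OF \<gamma>]
  have side: "A \<subseteq> ball c r \<or> A \<inter> cball c r = {}" if "connected A" "A \<inter> ?J = {}" for A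
  proof (rule ccontr)
    assume "\<not> ?thesis"
    moreover have "A \<inter> sphere c r = {}" using S that(2) by blast
    moreover have "ball c r \<union> sphere c r = cball c r" by auto
    ultimately have "A \<inter> ball c r \<noteq> {}" "A - ball c r \<noteq> {}" by blast+
    from connected_Int_frontier[OF that(1) this] S that(2) r show False by auto
  qed
  have out: "outside ?J \<inter> cball c r = {}"
  proof -
    have "\<not> outside ?J \<subseteq> ball c r" using J bounded_subset bounded_ball by blast
    thus ?thesis using side[of "outside ?J"] J outside_no_overlap[of ?J] by blast
  qed
  have "closure (outside ?J) \<inter> ball c r = {}"
    using out by (subst Int_commute, subst open_Int_closure_eq_empty) auto
  hence Jb: "?J \<inter> ball c r = {}"
    using J unfolding frontier_def by blast
  have "c \<notin> ?J" "c \<notin> outside ?J" using Jb out r by auto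
  moreover have "inside ?J \<union> outside ?J = - ?J" using J by blast
  ultimately have "c \<in> inside ?J" by blast
  hence "inside ?J \<subseteq> ball c r" using side[of "inside ?J"] J r inside_no_overlap[of ?J] by force
  hence "closure (inside ?J) \<subseteq> cball c r" by (simp add: closure_minimal subset_trans[OF _ ball_subset_cball])
  hence "?J \<subseteq> cball c r" using J unfolding frontier_def by blast
  moreover have "cball c r = ball c r \<union> sphere c r" by auto
  ultimately show ?thesis using Jb S by blast
qed

text \<open>A connected set off the frontier lies in \<open>G\<close> or in its complement. The
  exterior of the disc cannot lie in the bounded set \<open>G\<close>, so \<open>G\<close> meets the
  disc and contains it; being connected and off the circle, \<open>G\<close> does not leave
  it.\<close>

lemma bounded_connected_open_frontier_sphere:
  fixes c :: complex
  assumes G: "open G" "connected G" "bounded G" "G \<noteq> {}" and f: "frontier G = sphere c r" and r: "0 < r"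
  shows "G = ball c r"
proof -
  have disj: "G \<inter> sphere c r = {}" using f G(1) by (metis frontier_disjoint_eq inf_commute)
  have ext: "connected (- cball c r)"
    by (rule connected_complement_bounded_convex) auto
  have "G \<inter> ball c r \<noteq> {}"
  proof
    assume "G \<inter> ball c r = {}"
    hence "G \<subseteq> - cball c r" using disj by force
    moreover have "- cball c r \<subseteq> G"
    proof (rule ccontr)
      assume "\<not> - cball c r \<subseteq> G"
      moreover have "- cball c r \<inter> G \<noteq> {}" using \<open>G \<subseteq> - cball c r\<close> G(4) by blast
      ultimately have "- cball c r \<inter> frontier G \<noteq> {}"
        by (intro connected_Int_frontier ext) auto
      thus False using f by auto
    qed
    ultimately have "UNIV = G \<union> cball c r" by blast
    moreover have "bounded (G \<union> cball c r)" using G(3) by simp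
    ultimately show False by (metis not_bounded_UNIV)
  qed
  have "ball c r \<subseteq> G"
  proof (rule ccontr)
    assume "\<not> ball c r \<subseteq> G"
    hence "ball c r \<inter> frontier G \<noteq> {}"
      using \<open>G \<inter> ball c r \<noteq> {}\<close> by (intro connected_Int_frontier) auto
    thus False using f by auto
  qed
  moreover have "G \<subseteq> ball c r"
  proof (rule ccontr)
    assume "\<not> G \<subseteq> ball c r"
    hence "G \<inter> frontier (ball c r) \<noteq> {}"
      using \<open>G \<inter> ball c r \<noteq> {}\<close> G(2) by (intro connected_Int_frontier) auto
    thus False using disj r by auto
  qed
  ultimately show ?thesis by blast
qed

section \<open>Cauchy kernels on a circle\<close>

context circle_measure begin

text \<open>Multiplication by \<open>1 / (1 - \<kappa> * cnj (z - c))\<close> preserves the vanishing of all moments of positive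
  order: the moment of order \<open>m\<close> gets multiplied by \<open>\<kappa>\<close> and raised by one order.\<close>

lemma cnj_moments_geometric:
  assumes g: "g \<in> borel_measurable borel" "continuous_on (sphere c r) g"
    and zero: "\<And>m. 1 \<le> m \<Longrightarrow> (\<integral>z. cnj (z - c) ^ m * g z \<partial>M) = 0"
    and \<kappa>: "norm \<kappa> * r < 1" and m: "1 \<le> m"
  shows "(\<integral>z. cnj (z - c) ^ m * (g z / (1 - \<kappa> * cnj (z - c))) \<partial>M) = 0"
proof -
  note [measurable] = g(1)
  define q where "q = norm \<kappa> * r"
  have nx: "norm (cnj (z - c)) = r" if "dist c z = r" for z
    using that by (metis complex_mod_cnj dist_commute dist_norm)
  have nk: "norm (\<kappa> * cnj (z - c)) = q" if "dist c z = r" for z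
    using nx[OF that] by (simp add: norm_mult q_def del: complex_cnj_diff)
  have ne: "1 - \<kappa> * cnj (z - c) \<noteq> 0" if "dist c z = r" for z
    using nk[OF that] \<kappa> by (auto simp: q_def simp del: complex_cnj_diff)
  let ?h = "\<lambda>z. g z / (1 - \<kappa> * cnj (z - c))"
  have hm: "?h \<in> borel_measurable borel" using g(1) by measurable
  have hc: "continuous_on (sphere c r) ?h"
    using ne by (intro continuous_on_divide continuous_intros g) auto
  have gi: "integrable M (\<lambda>z. cnj (z - c) ^ m * g z)" for m
    by (rule integrable_continuous) (use g in \<open>auto intro!: continuous_intros\<close>)
  have hi: "integrable M (\<lambda>z. cnj (z - c) ^ m * ?h z)" for m
    by (rule integrable_continuous) (use hm hc in \<open>measurable, intro continuous_intros hc\<close>)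
  have step: "(\<integral>z. cnj (z - c) ^ m * ?h z \<partial>M) = \<kappa> * (\<integral>z. cnj (z - c) ^ Suc m * ?h z \<partial>M)" if m: "1 \<le> m" for m
  proof -
    have "(\<integral>z. cnj (z - c) ^ m * ?h z \<partial>M) = (\<integral>z. cnj (z - c) ^ m * g z + \<kappa> * (cnj (z - c) ^ Suc m * ?h z) \<partial>M)"
    proof (rule integral_cong_AE)
      have e: "x ^ m * (G / (1 - \<kappa> * x)) = x ^ m * G + \<kappa> * (x ^ Suc m * (G / (1 - \<kappa> * x)))"
        if "1 - \<kappa> * x \<noteq> 0" for x G :: complex
        using that by (simp add: field_simps)
      show "AE z in M. cnj (z - c) ^ m * ?h z = cnj (z - c) ^ m * g z + \<kappa> * (cnj (z - c) ^ Suc m * ?h z)"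
        using AE_circle by eventually_elim (rule e[OF ne])
    qed measurable
    also have "\<dots> = \<kappa> * (\<integral>z. cnj (z - c) ^ Suc m * ?h z \<partial>M)"
      by (simp only: Bochner_Integration.integral_add[OF gi integrable_mult_right[OF hi]] zero[OF m]
          integral_mult_right_zero add_0)
    finally show ?thesis .
  qed
  \<comment> \<open>Iteration produces the factor \<open>\<kappa> ^ n\<close> against integrals
    growing at most like \<open>r ^ n\<close>, and \<open>norm \<kappa> * r < 1\<close>.\<close>
  have iter: "(\<integral>z. cnj (z - c) ^ m * ?h z \<partial>M) = \<kappa> ^ n * (\<integral>z. cnj (z - c) ^ (m + n) * ?h z \<partial>M)" for n
  proof (induction n)
    case (Suc n)
    thus ?case using step[of "m + n"] m by (simp del: complex_cnj_diff)
  qed simp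
  obtain B where B: "\<And>z. z \<in> sphere c r \<Longrightarrow> norm (?h z) \<le> B"
    using compact_imp_bounded[OF compact_continuous_image[OF hc compact_sphere]]
    unfolding bounded_iff by blast
  define K where "K = r ^ m * B * measure M (space M)"
  have "norm (\<integral>z. cnj (z - c) ^ m * ?h z \<partial>M) \<le> q ^ n * K" for n
  proof -
    have "norm (\<integral>z. cnj (z - c) ^ (m + n) * ?h z \<partial>M) \<le> (\<integral>z. norm (cnj (z - c) ^ (m + n) * ?h z) \<partial>M)"
      by (rule integral_norm_bound)
    also have "\<dots> \<le> (\<integral>z. r ^ (m + n) * B \<partial>M)"
    proof (rule integral_mono_AE)
      show "AE z in M. norm (cnj (z - c) ^ (m + n) * ?h z) \<le> r ^ (m + n) * B"
        using AE_circle
      proof eventually_elim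
        fix z assume z: "dist c z = r"
        show "norm (cnj (z - c) ^ (m + n) * ?h z) \<le> r ^ (m + n) * B"
          unfolding norm_mult[of "_ ^ _"] norm_power nx[OF z]
          using B[of z] z r_pos by (intro mult_left_mono) auto
      qed
    qed (use hi in \<open>auto intro!: integrable_norm\<close>)
    finally have "norm (\<integral>z. cnj (z - c) ^ (m + n) * ?h z \<partial>M) \<le> r ^ (m + n) * B * measure M (space M)"
      by (simp add: mult_ac)
    hence "norm \<kappa> ^ n * norm (\<integral>z. cnj (z - c) ^ (m + n) * ?h z \<partial>M) \<le>
       norm \<kappa> ^ n * (r ^ (m + n) * B * measure M (space M))"
      by (intro mult_left_mono) auto
    thus ?thesis unfolding iter[of n] norm_mult norm_power
      by (simp add: q_def K_def power_mult_distrib power_add mult_ac)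
  qed
  moreover have "(\<lambda>n. q ^ n * K) \<longlonglongrightarrow> 0"
    using \<kappa> r_pos by (intro tendsto_mult_left_zero LIMSEQ_power_zero) (auto simp: q_def)
  ultimately have "norm (\<integral>z. cnj (z - c) ^ m * ?h z \<partial>M) \<le> 0"
    by (intro LIMSEQ_le_const) auto
  thus ?thesis by simp
qed

text \<open>With \<open>x = cnj (z - c)\<close> one has \<open>z - c = r^2 / x\<close> on the
  circle. The kernels become \<open>x / (r^2 * (1 - \<alpha> * x))\<close> and
  \<open>- \<beta> / (1 - \<beta> * x)\<close>, so their product is a multiple of a conjugate moment
  of order 1 with two geometric factors.\<close>

lemma Cauchy_kernels_orthogonal:
  assumes l: "dist c l < r" and \<mu>: "r < dist c \<mu>"
  shows "(\<integral>z. 1 / (z - l) * cnj (1 / (z - \<mu>)) \<partial>M) = 0"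
proof -
  \<comment> \<open>That \<open>l\<close> lies inside the circle makes
    \<open>norm \<alpha> * r\<close> less than 1; that \<open>\<mu>\<close> lies outside does the
    same for \<open>\<beta>\<close>.\<close>
  define \<alpha> where "\<alpha> = (l - c) / of_real (r^2)"
  define \<beta> where "\<beta> = 1 / cnj (\<mu> - c)"
  have \<mu>0: "\<mu> - c \<noteq> 0" using \<mu> r_pos by auto
  have \<alpha>: "norm \<alpha> * r < 1"
    using l r_pos by (simp add: \<alpha>_def norm_divide dist_norm norm_minus_commute norm_mult power2_eq_square field_simps)
  have \<beta>: "norm \<beta> * r < 1"
  proof -
    have "norm \<beta> = 1 / dist c \<mu>" 
      unfolding \<beta>_def norm_divide complex_mod_cnj by (simp add: dist_norm norm_minus_commute)
    moreover have "0 < dist c \<mu>" using \<mu> r_pos by linarith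
    ultimately show ?thesis using \<mu> by (simp add: pos_divide_less_eq)
  qed
  have b: "1 - \<beta> * cnj (z - c) \<noteq> 0" if "dist c z = r" for z
  proof -
    have "norm (cnj (z - c)) = r" using that by (metis complex_mod_cnj dist_commute dist_norm)
    hence "norm (\<beta> * cnj (z - c)) < 1" using \<beta> by (simp only: norm_mult)
    thus ?thesis by auto
  qed
  \<comment> \<open>The geometric factors are attached one at a time: the one with
    \<open>\<beta>\<close> to the constant 1, then the one with \<open>\<alpha>\<close> to the
    outcome.\<close>
  have 1: "(\<integral>z. cnj (z - c) ^ m * (1 / (1 - \<beta> * cnj (z - c))) \<partial>M) = 0" if "1 \<le> m" for m
    by (rule cnj_moments_geometric[OF _ _ _ \<beta> that]) (use cnj_power_integral in auto)
  have 2: "(\<integral>z. cnj (z - c) ^ 1 * (1 / (1 - \<beta> * cnj (z - c)) / (1 - \<alpha> * cnj (z - c))) \<partial>M) = 0"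
    by (rule cnj_moments_geometric[OF _ _ 1 \<alpha>])
      (use b in \<open>auto intro!: continuous_on_divide continuous_on_mult continuous_on_cnj continuous_on_diff\<close>)
  have "(\<integral>z. 1 / (z - l) * cnj (1 / (z - \<mu>)) \<partial>M) =
    (\<integral>z. (- \<beta> / of_real (r^2)) * (cnj (z - c) ^ 1 * (1 / (1 - \<beta> * cnj (z - c)) / (1 - \<alpha> * cnj (z - c)))) \<partial>M)"
  proof (rule integral_cong_AE)
    show "AE z in M. 1 / (z - l) * cnj (1 / (z - \<mu>)) =
      (- \<beta> / of_real (r^2)) * (cnj (z - c) ^ 1 * (1 / (1 - \<beta> * cnj (z - c)) / (1 - \<alpha> * cnj (z - c))))"
      using AE_circle
    proof eventually_elim
      fix z assume z: "dist c z = r"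
      define x where "x = cnj (z - c)"
      define R where "R = complex_of_real (r^2)"
      have "norm (z - c) = r" using z by (simp add: dist_norm norm_minus_commute)
      hence xz: "(z - c) * x = R"
        unfolding x_def R_def by (metis complex_norm_square of_real_power)
      have R0: "R \<noteq> 0" using r_pos by (simp add: R_def)
      hence x0: "x \<noteq> 0" using xz by auto
      have zl: "z - l = R * (1 - \<alpha> * x) / x"
      proof -
        have "(z - l) * x = (z - c) * x - (l - c) * x" by (simp add: algebra_simps)
        also have "\<dots> = R * (1 - \<alpha> * x)"
        proof -
          have "\<alpha> * R = l - c" using r_pos by (simp add: \<alpha>_def R_def)
          thus ?thesis unfolding xz by (metis mult.assoc mult.commute mult.right_neutral right_diff_distrib)
        qed
        finally show ?thesis using x0 by (simp add: field_simps)
      qed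
      have "cnj (z - \<mu>) = x - cnj (\<mu> - c)" by (simp add: x_def)
      also have "\<dots> = - (1 - \<beta> * x) / \<beta>"
        using \<mu>0 by (simp add: \<beta>_def field_simps del: complex_cnj_diff)
      finally have zm: "cnj (z - \<mu>) = - (1 - \<beta> * x) / \<beta>" .
      have "1 / (z - l) * cnj (1 / (z - \<mu>)) = 1 / (z - l) * (1 / cnj (z - \<mu>))"
        by (simp only: complex_cnj_divide complex_cnj_one)
      also have "\<dots> = (x / (R * (1 - \<alpha> * x))) * (- (\<beta> / (1 - \<beta> * x)))"
      proof -
        have "1 / (P / X) * (1 / (- Q / B)) = X / P * (- (B / Q))" for P Q B X :: complex
          by simp
        thus ?thesis unfolding zl zm .
      qed
      finally show "1 / (z - l) * cnj (1 / (z - \<mu>)) =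
        (- \<beta> / of_real (r^2)) * (cnj (z - c) ^ 1 * (1 / (1 - \<beta> * cnj (z - c)) / (1 - \<alpha> * cnj (z - c))))"
        by (simp add: x_def R_def mult_ac del: complex_cnj_diff)
    qed
  qed measurable
  thus ?thesis by (simp only: integral_mult_right_zero 2 mult_zero_right)
qed

end

section \<open>The characterisation of circles\<close>

lemma (in finite_measure) AE_False_iff: "(AE x in M. False) \<longleftrightarrow> measure M (space M) = 0"
  by (subst AE_iff_measurable[OF sets.top]) (auto simp: emeasure_eq_measure)

context planar_compact_measure begin

theorem orthogonal_Cauchy_kernels_imp_circle_measure:
  assumes mass: "measure M (space M) \<noteq> 0"
    and G: "G \<inter> C = {}" "C \<subseteq> closure G" "G \<noteq> {}"
    and orth: "\<And>l \<mu>. l \<in> G \<Longrightarrow> R < norm \<mu> \<Longrightarrow> (\<integral>z. 1 / (z - l) * cnj (1 / (z - \<mu>)) \<partial>M) = 0"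
  obtains c r where "circle_measure M c r"
proof -
  define c where "c = (\<integral>z. z \<partial>M) / of_real (measure M (space M))"
  have orth': "(\<integral>z. cnj (z - c) ^ n / (z - l) \<partial>M) = 0" if "l \<in> G" for l n
    by (rule orthogonal_to_polynomials[OF finite_measure_axioms sets_M AE_C compact_C])
      (use that G(1) orth in blast)+
  have m00: "moment c 0 0 = of_real (measure M (space M))"
    by (simp add: moment_def scaleR_conv_of_real)
  have "moment c 1 0 = (\<integral>z. z - c \<partial>M)" by (simp add: moment_def)
  also have "\<dots> = 0"
    using mass by (subst Bochner_Integration.integral_diff)
      (auto intro!: integrable_continuous continuous_intros simp: c_def scaleR_conv_of_real)
  finally have c: "moment c 0 1 = 0" using moment_commute[of c 1 0] by simp
  have M0: "moment c 0 0 \<noteq> 0" using m00 mass by simp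
  obtain r where r: "0 \<le> r" "AE z in M. dist c z = r"
    using concentrated_on_circle[OF M0 moment_2_2[OF orth' G(1,2) c M0]] by blast
  \<comment> \<open>For \<open>r = 0\<close> the measure would be a point mass at \<open>c\<close>,
    whose Cauchy integral at a point \<open>l\<close> of \<open>G\<close> is the mass divided by
    \<open>c - l\<close>, not zero.\<close>
  have "r \<noteq> 0"
  proof
    assume "r = 0"
    have AE: "AE z in M. z = c" using r(2) by eventually_elim (use \<open>r = 0\<close> in auto)
    hence "AE z in M. c \<in> C" using AE_C by eventually_elim simp
    hence cC: "c \<in> C" using mass by (cases "c \<in> C") (auto simp: AE_False_iff)
    obtain l where l: "l \<in> G" using G(3) by blast
    have "0 = (\<integral>z. 1 / (z - l) \<partial>M)" using orth'[OF l, of 0] by simp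
    also have "\<dots> = (\<integral>z. 1 / (c - l) \<partial>M)"
      by (rule integral_cong_AE) (use AE in auto)
    also have "\<dots> = of_real (measure M (space M)) / (c - l)" by (simp add: scaleR_conv_of_real)
    finally show False using mass cC l G(1) by auto
  qed
  have "(\<integral>z. (z - c) ^ n \<partial>M) = 0" if "0 < n" for n
  proof -
    have "(\<integral>z. (z - c) ^ n \<partial>M) = moment c n 0" by (simp add: moment_def)
    also have "\<dots> = cnj (moment c 0 n)" by (rule moment_commute)
    also have "\<dots> = 0" using moment_0_eq_0[OF orth' G(1,2) c M0, of n] that by simp
    finally show ?thesis .
  qed
  with r \<open>r \<noteq> 0\<close> have "circle_measure M c r"
    by unfold_locales (auto simp: sets_M)
  thus ?thesis by (rule that)
qed

end

lemma (in circle_measure) scale: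
  "circle_measure (density M (\<lambda>_. ennreal k)) c r"
proof -
  interpret D: finite_measure "density M (\<lambda>_. ennreal k)"
    by standard (simp add: emeasure_density nn_integral_cmult ennreal_mult_eq_top_iff)
  \<comment> \<open>\<open>ennreal\<close> sends negative numbers to 0, so \<open>k\<close> may be
    replaced by a nonnegative constant, as the integral formula for densities requires.\<close>
  have "density M (\<lambda>_. ennreal k) = density M (\<lambda>_. ennreal (max 0 k))"
    by (metis ennreal_neg linorder_not_le max_def order_less_imp_le)
  hence "(\<integral>z. (z - c) ^ n \<partial>density M (\<lambda>_. ennreal k)) = 0" if "0 < n" for n
    using power_integral[OF that] by (subst \<open>_ = density M _\<close>, subst integral_density) auto
  thus ?thesis
    by unfold_locales (use sets_M r_pos AE_circle in \<open>auto simp: AE_density\<close>)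
qed

theorem mainTheorem1:
  fixes G :: "complex set"
    and \<Gamma> :: "(real \<Rightarrow> complex) set"
    and w :: "complex \<Rightarrow> real"
  assumes "bounded_finitely_connected_domain G"
    and "finite \<Gamma>"
    and "\<And>\<gamma>. \<gamma> \<in> \<Gamma> \<Longrightarrow> rectifiable_jordan_path \<gamma>"
    and "disjoint_family_on path_image \<Gamma>"
    and "frontier G = curve_image \<Gamma>"
    and "carleson_curve \<Gamma>"
    and "\<And>z. z \<in> frontier G \<Longrightarrow> 0 \<le> w z"
    and "w \<in> borel_measurable (arc_length_measure \<Gamma>)"
    and "\<And>K. K \<in> components (frontier G) \<Longrightarrow>
           \<not> (AE z in arc_length_measure \<Gamma>. z \<in> K \<longrightarrow> w z = 0)"
    and "integrable (arc_length_measure \<Gamma>) w"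
  shows "(\<forall>l\<in>G. \<forall>\<mu>\<in>- closure G.
            weighted_inner \<Gamma> w (\<lambda>z. 1 / (z - l)) (\<lambda>z. 1 / (z - \<mu>)) = 0)
     \<longleftrightarrow> ((\<exists>c r. 0 < r \<and> frontier G = sphere c r) \<and>
          (\<exists>k. AE z in arc_length_measure \<Gamma>. w z = k))"
proof -
  define A where "A = arc_length_premeasure \<Gamma>"
  let ?l = "completion A"
  have l: "arc_length_measure \<Gamma> = ?l" by (simp add: A_def arc_length_measure_eq_completion)
  define C where "C = frontier G"
  have G: "open G" "connected G" "bounded G" "G \<noteq> {}"
    using assms(1) by (auto simp: bounded_finitely_connected_domain_def)
  have C: "compact C" using G(3) by (simp add: C_def compact_frontier_bounded)
  have C_ne: "C \<noteq> {}"
    using G(3,4) unfolding C_def by (metis frontier_not_empty not_bounded_UNIV)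
  have spA: "space A = C" by (simp add: A_def space_arc_length_premeasure C_def assms(5))
  have idA: "(\<lambda>z. z) \<in> measurable A borel"
    unfolding A_def by (rule id_measurable_arc_length_premeasure)
  have borelA: "f \<in> borel_measurable A" if "f \<in> borel_measurable borel" for f :: "complex \<Rightarrow> complex"
    using measurable_compose[OF idA that] .
  have simple: "simple_path \<gamma>" "pathfinish \<gamma> = pathstart \<gamma>" if "\<gamma> \<in> \<Gamma>" for \<gamma>
    using assms(3)[OF that] by (auto simp: rectifiable_jordan_path_def)
  have single: "\<exists>\<gamma>. \<Gamma> = {\<gamma>} \<and> simple_path \<gamma> \<and> pathfinish \<gamma> = pathstart \<gamma> \<and> path_image \<gamma> = C" if conn: "connected C"
  proof -
    obtain \<gamma> where "\<Gamma> = {\<gamma>}"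
      using disjoint_paths_connected_single[OF assms(2) _ assms(4) conn[unfolded C_def assms(5)]]
        C_ne[unfolded C_def assms(5)] simple(1) simple_path_imp_path by metis
    thus ?thesis using simple[of \<gamma>] assms(5) by (simp add: C_def curve_image_def)
  qed
  \<comment> \<open>Both directions rest on this: it supplies the measure with which
    \<open>w |dz|\<close> is compared, and the orthogonality in the converse.\<close>
  have circle: "circle_measure (distr A borel (\<lambda>z. z)) c r" if S: "C = sphere c r" and r: "0 < r" for c r
  proof -
    have "connected C" unfolding S by (rule connected_sphere) simp
    then obtain \<gamma> where "\<Gamma> = {\<gamma>}" "simple_path \<gamma>" "pathfinish \<gamma> = pathstart \<gamma>" "path_image \<gamma> = C"
      using single by blast
    thus ?thesis unfolding A_def using circle_measure_arc_length[of \<gamma> c r] S r by simp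
  qed

  show ?thesis
  proof (intro iffI conjI ballI)

    \<comment> \<open>From orthogonality to a circle\<close>
    assume orth: "\<forall>l\<in>G. \<forall>\<mu>\<in>- closure G. weighted_inner \<Gamma> w (\<lambda>z. 1 / (z - l)) (\<lambda>z. 1 / (z - \<mu>)) = 0"
    \<comment> \<open>\<open>w\<close> is measurable only for the completion; \<open>v\<close> is a
      Borel version of it, made nonnegative everywhere.\<close>
    obtain w0 where w0: "w0 \<in> borel_measurable A" "AE z in A. w z = w0 z"
      using completion_ex_borel_measurable_real[of w A] assms(8) unfolding l by blast
    define v where "v z = max 0 (w0 z)" for z
    have v[measurable]: "v \<in> borel_measurable A" unfolding v_def using w0(1) by measurable
    have v0: "0 \<le> v z" for z by (simp add: v_def)
    have wv: "AE z in A. w z = v z"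
      using w0(2) AE_space
    proof eventually_elim
      fix z assume "w z = w0 z" "z \<in> space A"
      thus "w z = v z" using assms(7)[of z] by (simp add: spA C_def v_def)
    qed
    hence wvl: "AE z in ?l. w z = v z" by (rule AE_completion)
    have "integrable ?l v"
      using integrable_cong_AE_imp[OF assms(10)[unfolded l] measurable_completion[OF v]] wvl
      by (auto elim: eventually_mono)
    hence iv: "integrable A v" using v by (simp add: integrable_completion)
    define D where "D = density A (\<lambda>z. ennreal (v z))"
    \<comment> \<open>\<open>M\<close> is \<open>w |dz|\<close> moved from the curve to the Borel
      sets of the plane.\<close>
    define M where "M = distr D borel (\<lambda>z. z)"
    have idD: "(\<lambda>z. z) \<in> measurable D borel" using idA by (simp add: D_def)
    interpret D: finite_measure D
    proof
      have "emeasure D (space D) = (\<integral>\<^sup>+z. ennreal (v z) \<partial>A)"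
        unfolding D_def by (subst emeasure_density) (auto intro!: nn_integral_cong simp: indicator_def)
      thus "emeasure D (space D) \<noteq> \<infinity>"
        using iv v0 by (simp add: nn_integral_eq_integral)
    qed
    interpret M: planar_compact_measure M C
    proof -
      interpret finite_measure M unfolding M_def by (rule D.finite_measure_distr[OF idD])
      have "C \<in> sets borel" using C by (simp add: borel_compact)
      hence "AE z in M. z \<in> C"
        unfolding M_def by (subst AE_distr_iff[OF idD]) (auto simp: D_def spA)
      thus "planar_compact_measure M C" by unfold_locales (auto simp: M_def C)
    qed
    have integral_M: "(\<integral>z. f z \<partial>M) = (\<integral>z. f z * of_real (w z) \<partial>arc_length_measure \<Gamma>)"
      if f: "f \<in> borel_measurable borel" for f :: "complex \<Rightarrow> complex"
    proof -
      note [measurable] = borelA[OF f]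
      have [measurable]: "w \<in> borel_measurable ?l" using assms(8) by (simp add: l)
      have "(\<integral>z. f z \<partial>M) = (\<integral>z. v z *\<^sub>R f z \<partial>A)"
        unfolding M_def D_def by (subst integral_distr[OF idD[unfolded D_def] f], subst integral_density) (auto simp: v0)
      also have "\<dots> = (\<integral>z. v z *\<^sub>R f z \<partial>?l)"
        by (rule integral_completion[symmetric]) measurable
      also have "\<dots> = (\<integral>z. f z * of_real (w z) \<partial>?l)"
      proof (rule integral_cong_AE)
        show "AE z in ?l. v z *\<^sub>R f z = f z * of_real (w z)"
          using wvl by eventually_elim (simp add: scaleR_conv_of_real mult.commute)
        show "(\<lambda>z. v z *\<^sub>R f z) \<in> borel_measurable ?l"
          by (rule measurable_completion) measurable
        show "(\<lambda>z. f z * of_real (w z)) \<in> borel_measurable ?l"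
          using measurable_completion[OF borelA[OF f]] by measurable
      qed
      finally show ?thesis by (simp add: l)
    qed
    \<comment> \<open>\<open>M\<close> has density \<open>v\<close> with respect to arc length, so
      what holds almost everywhere for \<open>M\<close> holds at almost all points of the curve
      where the weight does not vanish.\<close>
    have AE_w: "AE z in arc_length_measure \<Gamma>. w z \<noteq> 0 \<longrightarrow> P z"
      if P: "AE z in M. P z" "{z. P z} \<in> sets borel" for P
    proof -
      have "AE z in D. P z" using P(1) P(2) unfolding M_def by (subst (asm) AE_distr_iff[OF idD]) auto
      hence "AE z in A. 0 < v z \<longrightarrow> P z" unfolding D_def by (subst (asm) AE_density) auto
      hence "AE z in A. w z \<noteq> 0 \<longrightarrow> P z"
        using wv by eventually_elim (use v0 in \<open>auto simp: order_less_le\<close>)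
      thus ?thesis unfolding l by (rule AE_completion)
    qed
    have mass: "measure M (space M) \<noteq> 0"
    proof
      assume "measure M (space M) = 0"
      hence "AE z in M. False" by (simp add: M.AE_False_iff)
      hence "AE z in arc_length_measure \<Gamma>. w z \<noteq> 0 \<longrightarrow> False" by (rule AE_w) simp
      hence "AE z in arc_length_measure \<Gamma>. z \<in> K \<longrightarrow> w z = 0" for K by (auto elim: eventually_mono)
      moreover obtain K where "K \<in> components C" using C_ne by (metis components_eq_empty ex_in_conv)
      ultimately show False using assms(9) by (auto simp: C_def)
    qed
    obtain R where R: "closure G \<subseteq> ball 0 R"
      using bounded_subset_ballD[of "closure G" 0] G(3) by auto
    have disj: "G \<inter> C = {}" unfolding C_def using G(1) by (metis frontier_disjoint_eq inf_commute)
    have CG: "C \<subseteq> closure G" by (auto simp: C_def frontier_def)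
    obtain c r where "circle_measure M c r"
    proof (rule M.orthogonal_Cauchy_kernels_imp_circle_measure[OF mass disj CG G(4), of R])
      fix l \<mu> assume "l \<in> G" "R < norm (\<mu> :: complex)"
      hence "\<mu> \<in> - closure G" using R by force
      hence "weighted_inner \<Gamma> w (\<lambda>z. 1 / (z - l)) (\<lambda>z. 1 / (z - \<mu>)) = 0" using orth \<open>l \<in> G\<close> by blast
      moreover have "(\<lambda>z. 1 / (z - l) * cnj (1 / (z - \<mu>))) \<in> borel_measurable borel" by measurable
      ultimately show "(\<integral>z. 1 / (z - l) * cnj (1 / (z - \<mu>)) \<partial>M) = 0"
        by (simp add: weighted_inner_def integral_M)
    qed blast
    then interpret S: circle_measure M c r .
    \<comment> \<open>The open set \<open>- C\<close> is null for \<open>M\<close>, whose mass is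
      positive, so it cannot meet the circle.\<close>
    have sub: "sphere c r \<subseteq> C"
    proof (rule ccontr)
      assume "\<not> sphere c r \<subseteq> C"
      moreover have "open (- C)" using C by (simp add: compact_imp_closed open_Compl)
      ultimately show False
        using S.open_meets_circle_not_null[of "- C"] M.AE_C mass by auto
    qed
    have conn_S: "connected (sphere c r)" by (rule connected_sphere) simp
    have S_ne: "sphere c r \<noteq> {}" using S.r_pos by simp
    \<comment> \<open>The weight vanishes almost everywhere off the circle. A component missing the
      circle would thus carry no weight; so every component meets it and, by maximality, contains
      it.\<close>
    have comp: "sphere c r \<subseteq> K" if K: "K \<in> components C" for K
    proof -
      have "K \<inter> sphere c r \<noteq> {}"
      proof
        assume "K \<inter> sphere c r = {}"
        moreover have "AE z in arc_length_measure \<Gamma>. w z \<noteq> 0 \<longrightarrow> dist c z = r"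
          by (rule AE_w[OF S.AE_circle]) measurable
        ultimately have "AE z in arc_length_measure \<Gamma>. z \<in> K \<longrightarrow> w z = 0"
          by (auto elim!: eventually_mono)
        thus False using assms(9) K by (simp add: C_def)
      qed
      thus ?thesis using components_maximal[OF K conn_S sub] by blast
    qed
    have "connected C"
    proof -
      obtain K where K: "K \<in> components C" using C_ne by (metis components_eq_empty ex_in_conv)
      have "components C = {K}"
      proof -
        have "K' = K" if "K' \<in> components C" for K'
          using components_eq[OF that K] comp[OF that] comp[OF K] S_ne by blast
        thus ?thesis using K by blast
      qed
      hence "C = K" using Union_components[of C] by simp
      thus ?thesis using in_components_connected[OF K] by simp
    qed
    then obtain \<gamma> where \<gamma>: "\<Gamma> = {\<gamma>}" "simple_path \<gamma>" "pathfinish \<gamma> = pathstart \<gamma>" "path_image \<gamma> = C"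
      using single by blast
    have CS: "C = sphere c r"
      using Jordan_curve_superset_circle[OF \<gamma>(2,3) _ S.r_pos] sub \<gamma>(4) by simp
    thus "\<exists>c r. 0 < r \<and> frontier G = sphere c r" using S.r_pos by (auto simp: C_def)

    \<comment> \<open>Constancy of the weight\<close>
    interpret N: circle_measure "distr A borel (\<lambda>z. z)" c r by (rule circle[OF CS S.r_pos])
    let ?N = "distr A borel (\<lambda>z. z)"
    have massA: "emeasure ?N (space ?N) = emeasure A (space A)"
      by (subst emeasure_distr[OF idA]) auto
    have finA: "finite_measure A"
      by (rule finite_measureI) (use massA N.emeasure_finite[of "space ?N"] in simp)
    interpret A: finite_measure A by (rule finA)
    show "\<exists>k. AE z in arc_length_measure \<Gamma>. w z = k"
    \<comment> \<open>With total arc length 0 every property holds almost everywhere; otherwise the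
      total can be divided by.\<close>
    proof (cases "measure ?N (space ?N) = 0")
      case True
      hence "AE z in A. False"
        using massA by (simp add: A.AE_False_iff N.emeasure_eq_measure A.emeasure_eq_measure)
      hence "AE z in arc_length_measure \<Gamma>. w z = 0"
        unfolding l by (intro AE_completion) (auto elim: eventually_mono)
      thus ?thesis by blast
    next
      case False
      \<comment> \<open>This ratio gives \<open>k\<close> times arc length the mass of
        \<open>M\<close>, so that uniqueness identifies the two measures.\<close>
      define k where "k = measure M (space M) / measure ?N (space ?N)"
      have k0: "0 \<le> k" by (simp add: k_def)
      have "emeasure (density ?N (\<lambda>_. ennreal k)) (space ?N) = ennreal k * emeasure ?N (space ?N)"
        by (subst emeasure_density) (auto simp: nn_integral_cmult)
      also have "\<dots> = ennreal (measure M (space M))"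
        using False k0 by (simp add: N.emeasure_eq_measure k_def flip: ennreal_mult)
      finally have "measure (density ?N (\<lambda>_. ennreal k)) (space (density ?N (\<lambda>_. ennreal k))) = measure M (space M)"
        by (simp add: measure_def)
      hence "M = density ?N (\<lambda>_. ennreal k)"
        by (intro circle_measure_unique[OF S.circle_measure_axioms N.scale]) simp
      also have "\<dots> = distr (density A (\<lambda>_. ennreal k)) borel (\<lambda>z. z)"
        by (rule density_distr) (use idA in auto)
      finally have MD: "distr D borel (\<lambda>z. z) = distr (density A (\<lambda>_. ennreal k)) borel (\<lambda>z. z)"
        by (simp add: M_def)
      \<comment> \<open>Measurable sets of the curve are traces of Borel sets, so equality of the
        images in the plane descends to the curve, where uniqueness of densities gives
        \<open>v = k\<close> almost everywhere.\<close>
      have "D = density A (\<lambda>_. ennreal k)"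
      proof (rule measure_eqI)
        fix X assume "X \<in> sets D"
        hence "X \<in> sets (restrict_space borel C)"
          by (simp add: D_def A_def sets_arc_length_premeasure C_def assms(5))
        then obtain Y where Y: "Y \<in> sets borel" "X = (\<lambda>z. z) -` Y \<inter> C"
          unfolding sets_restrict_space by auto
        have "emeasure D X = emeasure (distr D borel (\<lambda>z. z)) Y"
          by (subst emeasure_distr[OF idD Y(1)]) (simp add: D_def spA Y(2))
        also have "\<dots> = emeasure (density A (\<lambda>_. ennreal k)) X"
          unfolding MD by (subst emeasure_distr[OF _ Y(1)]) (use idA in \<open>simp_all add: spA Y(2)\<close>)
        finally show "emeasure D X = emeasure (density A (\<lambda>_. ennreal k)) X" .
      qed (simp add: D_def)
      hence "AE z in A. ennreal (v z) = ennreal k"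
        unfolding D_def by (subst (asm) A.density_unique_iff) auto
      hence "AE z in A. w z = k"
        using wv by eventually_elim (use v0 k0 in auto)
      thus ?thesis unfolding l by (intro exI AE_completion)
    qed
  next

    \<comment> \<open>Orthogonality for a constant weight on a circle\<close>
    fix l \<mu>
    assume "(\<exists>c r. 0 < r \<and> frontier G = sphere c r) \<and> (\<exists>k. AE z in arc_length_measure \<Gamma>. w z = k)"
    then obtain c r k where r: "0 < r" and S: "C = sphere c r" and k: "AE z in ?l. w z = k"
      unfolding C_def l by blast
    assume "l \<in> G" "\<mu> \<in> - closure G"
    moreover have "G = ball c r"
      using bounded_connected_open_frontier_sphere[OF G _ r] S by (simp add: C_def)
    ultimately have lm: "dist c l < r" "r < dist c \<mu>" using r by auto
    interpret N: circle_measure "distr A borel (\<lambda>z. z)" c r by (rule circle[OF S r])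
    let ?f = "\<lambda>z. 1 / (z - l) * cnj (1 / (z - \<mu>))"
    have f: "?f \<in> borel_measurable borel" by measurable
    have [measurable]: "w \<in> borel_measurable ?l" using assms(8) by (simp add: l)
    note fA = borelA[OF f]
    have "(\<integral>z. ?f z * of_real (w z) \<partial>?l) = (\<integral>z. of_real k * ?f z \<partial>?l)"
    proof (rule integral_cong_AE)
      show "AE z in ?l. ?f z * of_real (w z) = of_real k * ?f z"
        using k by eventually_elim (simp add: mult.commute)
    qed (use measurable_completion[OF fA] in measurable)
    also have "\<dots> = of_real k * (\<integral>z. ?f z \<partial>?l)" by (rule integral_mult_right_zero)
    also have "(\<integral>z. ?f z \<partial>?l) = (\<integral>z. ?f z \<partial>A)" by (rule integral_completion[OF fA])
    also have "\<dots> = (\<integral>z. ?f z \<partial>distr A borel (\<lambda>z. z))" by (rule integral_distr[OF idA f, symmetric])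
    also have "\<dots> = 0" by (rule N.Cauchy_kernels_orthogonal[OF lm])
    finally show "weighted_inner \<Gamma> w (\<lambda>z. 1 / (z - l)) (\<lambda>z. 1 / (z - \<mu>)) = 0"
      by (simp add: weighted_inner_def l)
  qed
qed

end
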